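(* Let $\mathfrak g$ be an affine Kac–Moody algebra with set of real roots $\Phi$. Let $\Psi$ be a closed subroot system of $\Phi$ and let $\Delta(\Psi)$ be the set of roots of $\mathfrak g(\Psi)$ with respect to $\mathfrak h$. Then $\Psi=\Delta(\Psi)\cap\Phi$. Thus the map $\Psi\mapsto\mathfrak g(\Psi)$ is a one-to-one correspondence between the set of closed subroot systems of $\Phi$ and the set of regular subalgebras of $\mathfrak g$.
   Context: $\mathfrak g$ is the affine Kac–Moody algebra over $\mathbb C$ attached to an indecomposable affine Cartan matrix (untwisted or twisted), with Cartan subalgebra $\mathfrak h$, root spaces $\mathfrak g_\alpha$, set of roots $\Delta(\mathfrak g)$ (nonzero), and set of real roots $\Phi\subset\Delta(\mathfrak g)$; $(\cdot,\cdot)$ is a standard symmetric non-degenerate invariant form on $\mathfrak h^*$, $\langle\beta,\alpha^\vee\rangle=2(\beta,\alpha)/(\alpha,\alpha)$ and $\mathbf s_\alpha(\beta)=\beta-\langle\beta,\alpha^\vee\rangle\alpha$ for $\alpha\in\Phi$. A non-empty subset $\Psi\subseteq\Phi$ is a closed subroot system if $\mathbf s_\alpha(\beta)\in\Psi$ for all $\alpha,\beta\in\Psi$, and $\alpha,\beta\in\Psi$ with $\alpha+\beta\in\Phi$ imply $\alpha+\beta\in\Psi$. $\mathfrak g(\Psi)$ is the Lie subalgebra of $\mathfrak g$ generated by the $\mathfrak g_\alpha$, $\alpha\in\Psi$; it is called the regular subalgebra associated with $\Psi$, and a regular subalgebra of $\mathfrak g$ is a subalgebra of this form. $\Delta(\Psi)=\{\alpha\in\Delta(\mathfrak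 g):\mathfrak g_\alpha\cap\mathfrak g(\Psi)\ne0\}$. *)

theory Defs
  imports "HOL-Analysis.Analysis" "HOL-Library.Function_Algebras"
begin

section \<open>Lie algebras\<close>

locale lie_algebra = vector_space scale
  for scale :: "'k::field \<Rightarrow> 'g::ab_group_add \<Rightarrow> 'g" +
  fixes bracket :: "'g \<Rightarrow> 'g \<Rightarrow> 'g"
  assumes bracket_add_left: "bracket (x + y) z = bracket x z + bracket y z"
    and bracket_add_right: "bracket x (y + z) = bracket x y + bracket x z"
    and bracket_scale_left: "bracket (scale c x) y = scale c (bracket x y)"
    and bracket_scale_right: "bracket x (scale c y) = scale c (bracket x y)"
    and bracket_self: "bracket x x = 0"
    and jacobi: "bracket x (bracket y z) + bracket y (bracket z x) + bracket z (bracket x y) = 0"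
begin

definition lie_subalgebra :: "'g set \<Rightarrow> bool" where
  "lie_subalgebra S \<longleftrightarrow> subspace S \<and> (\<forall>x\<in>S. \<forall>y\<in>S. bracket x y \<in> S)"

definition lie_ideal :: "'g set \<Rightarrow> bool" where
  "lie_ideal I \<longleftrightarrow> subspace I \<and> (\<forall>x. \<forall>y\<in>I. bracket x y \<in> I)"

end

text \<open>
  The dual of a subspace \<open>H\<close>. A functional on \<open>H\<close> is represented by its extension by zero
  outside \<open>H\<close> (so not by a linear map on the whole space). This makes equality of functionals
  equality of functions, and the pointwise operations on functions are the vector space
  operations of the dual.
\<close>

definition dual_space :: "('k::field \<Rightarrow> 'g::ab_group_add \<Rightarrow> 'g) \<Rightarrow> 'g set \<Rightarrow> ('g \<Rightarrow> 'k) set" where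
  "dual_space sc H = {f. (\<forall>x\<in>H. \<forall>y\<in>H. f (x + y) = f x + f y) \<and>
     (\<forall>c. \<forall>x\<in>H. f (sc c x) = c * f x) \<and> (\<forall>x. x \<notin> H \<longrightarrow> f x = 0)}"

definition fun_scale :: "'k::field \<Rightarrow> ('g \<Rightarrow> 'k) \<Rightarrow> ('g \<Rightarrow> 'k)" where
  "fun_scale c f = (\<lambda>x. c * f x)"


section \<open>Cartan matrices of affine type\<close>

definition generalized_cartan_matrix :: "int^'n^'n \<Rightarrow> bool" where
  "generalized_cartan_matrix A \<longleftrightarrow> (\<forall>i. A $ i $ i = 2) \<and> (\<forall>i j. i \<noteq> j \<longrightarrow> A $ i $ j \<le> 0) \<and>
     (\<forall>i j. A $ i $ j = 0 \<longrightarrow> A $ j $ i = 0)"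

definition indecomposable :: "int^'n^'n \<Rightarrow> bool" where
  "indecomposable A \<longleftrightarrow>
     \<not> (\<exists>S. S \<noteq> {} \<and> S \<noteq> UNIV \<and> (\<forall>i\<in>S. \<forall>j\<in>-S. A $ i $ j = 0 \<and> A $ j $ i = 0))"

text \<open>
  Kac's trichotomy (Infinite Dimensional Lie Algebras, Theorem 4.3), case (Aff). Together
  with the two preceding conditions this covers all untwisted and twisted affine matrices.
\<close>

definition affine_type :: "int^'n^'n \<Rightarrow> bool" where
  "affine_type A \<longleftrightarrow> (let M = map_matrix real_of_int A in
     rank M + 1 = CARD('n) \<and>
     (\<exists>u. (\<forall>i. u $ i > 0) \<and> M *v u = 0) \<and>
     (\<forall>v. (\<forall>i. (M *v v) $ i \<ge> 0) \<longrightarrow> M *v v = 0))"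

definition affine_cartan_matrix :: "int^'n^'n \<Rightarrow> bool" where
  "affine_cartan_matrix A \<longleftrightarrow> generalized_cartan_matrix A \<and> indecomposable A \<and> affine_type A"


section \<open>Kac--Moody algebras\<close>

record ('g, 'n) km_data =
  smult :: "complex \<Rightarrow> 'g \<Rightarrow> 'g"
  bracket :: "'g \<Rightarrow> 'g \<Rightarrow> 'g"
  cartan :: "'g set"
  coroot :: "'n \<Rightarrow> 'g"
  simple_root :: "'n \<Rightarrow> 'g \<Rightarrow> complex"
  chev_e :: "'n \<Rightarrow> 'g"
  chev_f :: "'n \<Rightarrow> 'g"

text \<open>
  The data \<open>G\<close> present the Kac--Moody algebra of \<open>A\<close> in the sense of Kac: the Lie algebra is
  the whole type \<open>'g\<close>; the first group of assumptions says that
  \<open>(cartan, simple_root, coroot)\<close> is a (minimal) realization of \<open>A\<close> inside it; generation and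
  the Chevalley relations say that it is a quotient of the Lie algebra with these generators
  and relations; and the condition on ideals says that the quotient is the one by the largest
  ideal meeting the Cartan subalgebra trivially.
\<close>

locale kac_moody_algebra =
  lie_algebra "smult G" "bracket G"
  for G :: "('g::ab_group_add, 'n::finite) km_data" and A :: "int^'n^'n" +
  assumes cartan_subspace: "subspace (cartan G)"
    and dim_cartan: "dim (cartan G) + rank (map_matrix real_of_int A) = 2 * CARD('n)"
    and coroot_in: "coroot G i \<in> cartan G"
    and coroot_indep: "inj (coroot G)" "\<not> dependent (range (coroot G))"
    and simple_root_in: "simple_root G i \<in> dual_space (smult G) (cartan G)"
    and simple_root_indep: "inj (simple_root G)"
      "\<not> module.dependent fun_scale (range (simple_root G))"
    and simple_root_coroot: "simple_root G j (coroot G i) = of_int (A $ i $ j)"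
    and cartan_abelian: "h \<in> cartan G \<Longrightarrow> h' \<in> cartan G \<Longrightarrow> bracket G h h' = 0"
    and bracket_e_f: "bracket G (chev_e G i) (chev_f G j) = (if i = j then coroot G i else 0)"
    and bracket_h_e: "h \<in> cartan G \<Longrightarrow>
      bracket G h (chev_e G i) = smult G (simple_root G i h) (chev_e G i)"
    and bracket_h_f: "h \<in> cartan G \<Longrightarrow>
      bracket G h (chev_f G i) = smult G (- simple_root G i h) (chev_f G i)"
    and generated: "lie_subalgebra hull (cartan G \<union> range (chev_e G) \<union> range (chev_f G)) = UNIV"
    and no_ideal: "lie_ideal I \<Longrightarrow> I \<inter> cartan G = {0} \<Longrightarrow> I = {0}"

definition affine_kac_moody_algebra ::
  "('g::ab_group_add, 'n::finite) km_data \<Rightarrow> int^'n^'n \<Rightarrow> bool" where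
  "affine_kac_moody_algebra G A \<longleftrightarrow> affine_cartan_matrix A \<and> kac_moody_algebra G A"


section \<open>Roots\<close>

definition cartan_dual :: "('g::ab_group_add, 'n) km_data \<Rightarrow> ('g \<Rightarrow> complex) set" where
  "cartan_dual G = dual_space (smult G) (cartan G)"

definition root_space :: "('g::ab_group_add, 'n) km_data \<Rightarrow> ('g \<Rightarrow> complex) \<Rightarrow> 'g set" where
  "root_space G \<alpha> = {x. \<forall>h\<in>cartan G. bracket G h x = smult G (\<alpha> h) x}"

definition roots :: "('g::ab_group_add, 'n) km_data \<Rightarrow> ('g \<Rightarrow> complex) set" where
  "roots G = {\<alpha> \<in> cartan_dual G. \<alpha> \<noteq> 0 \<and> root_space G \<alpha> \<noteq> {0}}"

definition simple_reflection ::
  "('g, 'n) km_data \<Rightarrow> 'n \<Rightarrow> ('g \<Rightarrow> complex) \<Rightarrow> ('g \<Rightarrow> complex)" where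
  "simple_reflection G i \<beta> = \<beta> - fun_scale (\<beta> (coroot G i)) (simple_root G i)"

text \<open>The simple reflections are involutions, so words in them already form the Weyl group.\<close>

inductive_set weyl_group :: "('g, 'n) km_data \<Rightarrow> (('g \<Rightarrow> complex) \<Rightarrow> ('g \<Rightarrow> complex)) set"
  for G :: "('g, 'n) km_data" where
  "id \<in> weyl_group G"
| "w \<in> weyl_group G \<Longrightarrow> simple_reflection G i \<circ> w \<in> weyl_group G"

definition real_roots :: "('g::ab_group_add, 'n) km_data \<Rightarrow> ('g \<Rightarrow> complex) set" where
  "real_roots G = {\<alpha> \<in> roots G. \<exists>w\<in>weyl_group G. \<exists>i. w \<alpha> = simple_root G i}"

text \<open>
  A standard form on the dual of the Cartan subalgebra: the symmetrizing factors \<open>\<epsilon> i\<close> are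
  those of a decomposition \<open>A = diag(\<epsilon>) B\<close> with \<open>B\<close> symmetric, and the last condition is
  the image of Kac's \<open>(\<alpha>\<^sub>i\<^sup>\<or> | h) = \<epsilon>\<^sub>i \<alpha>\<^sub>i(h)\<close>; it makes the form invariant under the Weyl
  group. Nothing is imposed on a complement of the span of the simple roots.
\<close>

definition standard_form :: "('g::ab_group_add, 'n) km_data \<Rightarrow>
    (('g \<Rightarrow> complex) \<Rightarrow> ('g \<Rightarrow> complex) \<Rightarrow> complex) \<Rightarrow> bool" where
  "standard_form G B \<longleftrightarrow>
     (\<forall>\<beta>\<in>cartan_dual G. \<forall>\<gamma>\<in>cartan_dual G. \<forall>\<mu>\<in>cartan_dual G. B (\<beta> + \<gamma>) \<mu> = B \<beta> \<mu> + B \<gamma> \<mu>) \<and>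
     (\<forall>c. \<forall>\<beta>\<in>cartan_dual G. \<forall>\<mu>\<in>cartan_dual G. B (fun_scale c \<beta>) \<mu> = c * B \<beta> \<mu>) \<and>
     (\<forall>\<beta>\<in>cartan_dual G. \<forall>\<mu>\<in>cartan_dual G. B \<beta> \<mu> = B \<mu> \<beta>) \<and>
     (\<forall>\<beta>\<in>cartan_dual G. (\<forall>\<mu>\<in>cartan_dual G. B \<beta> \<mu> = 0) \<longrightarrow> \<beta> = 0) \<and>
     (\<exists>\<epsilon> :: 'n \<Rightarrow> real. \<forall>i. \<epsilon> i > 0 \<and>
        (\<forall>\<beta>\<in>cartan_dual G. of_real (\<epsilon> i) * B (simple_root G i) \<beta> = \<beta> (coroot G i)))"

definition cartan_pairing :: "(('g \<Rightarrow> complex) \<Rightarrow> ('g \<Rightarrow> complex) \<Rightarrow> complex) \<Rightarrow>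
    ('g \<Rightarrow> complex) \<Rightarrow> ('g \<Rightarrow> complex) \<Rightarrow> complex" where
  "cartan_pairing B \<beta> \<alpha> = 2 * B \<beta> \<alpha> / B \<alpha> \<alpha>"

definition reflection :: "(('g \<Rightarrow> complex) \<Rightarrow> ('g \<Rightarrow> complex) \<Rightarrow> complex) \<Rightarrow>
    ('g \<Rightarrow> complex) \<Rightarrow> ('g \<Rightarrow> complex) \<Rightarrow> ('g \<Rightarrow> complex)" where
  "reflection B \<alpha> \<beta> = \<beta> - fun_scale (cartan_pairing B \<beta> \<alpha>) \<alpha>"


section \<open>Closed subroot systems and regular subalgebras\<close>

definition closed_subroot_system :: "('g::ab_group_add, 'n) km_data \<Rightarrow>
    (('g \<Rightarrow> complex) \<Rightarrow> ('g \<Rightarrow> complex) \<Rightarrow> complex) \<Rightarrow> ('g \<Rightarrow> complex) set \<Rightarrow> bool" where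
  "closed_subroot_system G B \<Psi> \<longleftrightarrow> \<Psi> \<noteq> {} \<and> \<Psi> \<subseteq> real_roots G \<and>
     (\<forall>\<alpha>\<in>\<Psi>. \<forall>\<beta>\<in>\<Psi>. reflection B \<alpha> \<beta> \<in> \<Psi>) \<and>
     (\<forall>\<alpha>\<in>\<Psi>. \<forall>\<beta>\<in>\<Psi>. \<alpha> + \<beta> \<in> real_roots G \<longrightarrow> \<alpha> + \<beta> \<in> \<Psi>)"

definition generated_subalgebra ::
  "('g::ab_group_add, 'n) km_data \<Rightarrow> ('g \<Rightarrow> complex) set \<Rightarrow> 'g set" where
  "generated_subalgebra G \<Psi> =
     lie_algebra.lie_subalgebra (smult G) (bracket G) hull (\<Union>\<alpha>\<in>\<Psi>. root_space G \<alpha>)"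

definition regular_subalgebra :: "('g::ab_group_add, 'n) km_data \<Rightarrow>
    (('g \<Rightarrow> complex) \<Rightarrow> ('g \<Rightarrow> complex) \<Rightarrow> complex) \<Rightarrow> 'g set \<Rightarrow> bool" where
  "regular_subalgebra G B S \<longleftrightarrow>
     (\<exists>\<Psi>. closed_subroot_system G B \<Psi> \<and> S = generated_subalgebra G \<Psi>)"

definition subalgebra_roots ::
  "('g::ab_group_add, 'n) km_data \<Rightarrow> ('g \<Rightarrow> complex) set \<Rightarrow> ('g \<Rightarrow> complex) set" where
  "subalgebra_roots G \<Psi> = {\<alpha> \<in> roots G. root_space G \<alpha> \<inter> generated_subalgebra G \<Psi> \<noteq> {0}}"

end

theory Submission
  imports Defs
begin

text \<open>
  The content of the theorem is that no real root outside \<open>\<Psi>\<close> occurs in the subalgebra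
  generated by the root spaces of a closed subroot system \<open>\<Psi>\<close>. Then \<open>\<Psi>\<close> can be recovered from
  its subalgebra, and the correspondence is one-to-one.

  Let \<open>V\<close> be spanned by the root spaces \<open>g\<^sub>\<alpha>\<close> with \<open>\<alpha> \<in> \<Psi>\<close> together with the brackets
  \<open>[g\<^sub>\<alpha>, g\<^sub>\<beta>]\<close> with \<open>\<alpha>, \<beta> \<in> \<Psi>\<close> and \<open>\<alpha> + \<beta>\<close> not a real root. It suffices that \<open>V\<close> is a
  subalgebra (\<open>generated_subalgebra_weights\<close>), since its weights that are real roots are in \<open>\<Psi>\<close>. The
  Jacobi identity reduces this to brackets \<open>[[z, x], y]\<close> of root vectors of weights
  \<open>\<gamma>, \<alpha>, \<beta> \<in> \<Psi>\<close> such that \<open>[x, y]\<close> is non-zero and \<open>\<alpha> + \<beta>\<close> is not a real root. If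
  \<open>\<gamma> + \<alpha>\<close> is a real root, it is in \<open>\<Psi>\<close>, and the bracket is in \<open>V\<close>. Otherwise either \<open>[z, x] = 0\<close>, or
  both \<open>\<gamma> + \<alpha>\<close> and \<open>\<alpha> + \<beta>\<close> are imaginary roots or zero. They are then integral multiples of a single
  isotropic vector \<open>\<mu>\<close>, say \<open>p \<mu>\<close> and \<open>q \<mu>\<close> with \<open>p, q\<close> coprime (unless one of them is zero). The
  integers \<open>n\<close> with \<open>\<alpha> - n \<mu> \<in> \<Psi>\<close> contain \<open>0, p, q\<close> and are closed under \<open>(m, n) \<mapsto> 2 m - n\<close>, because \<open>\<Psi>\<close>
  is closed under reflections. A parity argument shows that they contain \<open>p + q\<close>, and therefore
  \<open>\<gamma> + \<alpha> + \<beta> \<in> \<Psi>\<close> (\<open>subsystem_sum_three\<close>).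

  This uses one fact about affine algebras: the roots that are not real are integral combinations
  of simple roots that vanish on all coroots (\<open>nonreal_root_in_kernel\<close>), so that, the kernel of the
  Cartan matrix being a line, any two of them are commensurable. It is proved by descent on the
  height (\<open>positive_weight_in_kernel\<close>), which needs that roots have coefficients of one sign
  (\<open>weight_is_word_weight\<close>) and can be reflected. The latter rests on the representation
  theory of \<open>sl\<^sub>2\<close> (\<open>f_power_nonzero\<close>), which applies because the \<open>e\<^sub>i\<close> act locally nilpotently. This
  in turn follows from the Serre relations, which hold because a positive weight vector killed
  by all \<open>f\<^sub>k\<close> would generate an ideal that meets the Cartan subalgebra only in zero
  (\<open>lowest_weight_vector_eq_0\<close>).
\<close>

section \<open>Brackets, ideals and local nilpotency\<close>

context lie_algebra
begin

lemma bracket_zero_left [simp]: "bracket 0 x = 0"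
  using bracket_scale_left[of 0 0 x] by simp

lemma bracket_zero_right [simp]: "bracket x 0 = 0"
  using bracket_scale_right[of x 0 0] by simp

lemma bracket_anticomm: "bracket x y = - bracket y x"
proof -
  have "bracket (x + y) (x + y) = 0" by (rule bracket_self)
  then have "bracket x y + bracket y x = 0"
    unfolding bracket_add_left bracket_add_right by (simp add: bracket_self add.commute)
  then show ?thesis by (simp add: eq_neg_iff_add_eq_0)
qed

lemma bracket_minus_right: "bracket x (- y) = - bracket x y"
  using bracket_scale_right[of x "-1" y] by simp

text \<open>
  The Jacobi identity in the form used throughout: \<open>ad x\<close> is a derivation.
\<close>

lemma bracket_derivation:
  "bracket x (bracket y z) = bracket (bracket x y) z + bracket y (bracket x z)"
proof -
  have "bracket x (bracket y z) = - bracket y (bracket z x) - bracket z (bracket x y)"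
    using jacobi[of x y z] by (simp add: eq_neg_iff_add_eq_0 algebra_simps)
  also have "bracket z x = - bracket x z" by (rule bracket_anticomm)
  also have "bracket z (bracket x y) = - bracket (bracket x y) z" by (rule bracket_anticomm)
  finally show ?thesis by (simp add: bracket_minus_right)
qed

lemma bracket_span:
  assumes "subspace U" "\<And>s. s \<in> S \<Longrightarrow> bracket a s \<in> U" "x \<in> span S"
  shows "bracket a x \<in> U"
proof -
  have "subspace {y. bracket a y \<in> U}"
    using assms(1) by (simp add: subspace_def bracket_add_right bracket_scale_right)
  then show ?thesis using span_minimal[of S "{y. bracket a y \<in> U}"] assms(2,3) by auto
qed

lemma bracket_span_left:
  assumes "subspace U" "\<And>s. s \<in> S \<Longrightarrow> bracket s a \<in> U" "x \<in> span S"
  shows "bracket x a \<in> U"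
  using bracket_span[OF assms(1), of S a x] assms(2,3) bracket_anticomm
  by (metis assms(1) subspace_neg)

lemma subalgebra_hull_minimal:
  "lie_subalgebra U \<Longrightarrow> S \<subseteq> U \<Longrightarrow> lie_subalgebra hull S \<subseteq> U"
  by (rule hull_minimal)

text \<open>
  The normaliser of a subspace is a subalgebra, so invariance need only be tested on generators.
\<close>

lemma lie_ideal_if_generators:
  assumes gen: "lie_subalgebra hull S = UNIV" and U: "subspace U"
    and S: "\<And>s u. s \<in> S \<Longrightarrow> u \<in> U \<Longrightarrow> bracket s u \<in> U"
  shows "lie_ideal U"
proof -
  let ?N = "{x. \<forall>u\<in>U. bracket x u \<in> U}"
  have "lie_subalgebra ?N"
    unfolding lie_subalgebra_def
  proof (intro conjI ballI)
    show "subspace ?N"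
      using U by (auto simp: subspace_def bracket_add_left bracket_scale_left)
    fix x y assume "x \<in> ?N" "y \<in> ?N"
    moreover have "bracket (bracket x y) u = bracket x (bracket y u) - bracket y (bracket x u)" for u
      using bracket_derivation[of x y u] by simp
    ultimately show "bracket x y \<in> ?N" using subspace_diff[OF U] by auto
  qed
  then have "UNIV \<subseteq> ?N" using subalgebra_hull_minimal[of ?N S] S gen by auto
  then show ?thesis using U by (auto simp: lie_ideal_def)
qed

text \<open>
  A weak Leibniz rule: one application of the derivation turns \<open>[x, y]\<close> into two brackets for which
  \<open>a + b\<close> has dropped by one, so no binomial coefficients are needed.
\<close>

lemma ad_nilpotent_bracket:
  "((bracket d) ^^ a) x = 0 \<Longrightarrow> ((bracket d) ^^ b) y = 0 \<Longrightarrow> ((bracket d) ^^ (a + b)) (bracket x y) = 0"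
proof (induction "a + b" arbitrary: a b x y)
  case 0
  then show ?case by simp
next
  case (Suc n)
  have lin: "((bracket d) ^^ k) (u + v) = ((bracket d) ^^ k) u + ((bracket d) ^^ k) v" for k u v
    by (induction k) (auto simp: bracket_add_right)
  have z: "((bracket d) ^^ k) 0 = 0" for k
    by (induction k) auto
  have ab: "a + b = Suc n" using Suc by simp
  have "((bracket d) ^^ (a + b)) (bracket x y) =
      ((bracket d) ^^ n) (bracket (bracket d x) y) + ((bracket d) ^^ n) (bracket x (bracket d y))"
    unfolding ab funpow_Suc_right o_def bracket_derivation[of d x y] lin ..
  also have "((bracket d) ^^ n) (bracket (bracket d x) y) = 0"
  proof (cases a)
    case 0
    then show ?thesis using Suc.prems z by simp
  next
    case (Suc a')
    then show ?thesis
      using Suc.hyps(1)[of a' b "bracket d x" y] Suc.prems ab by (simp add: funpow_swap1)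
  qed
  also have "((bracket d) ^^ n) (bracket x (bracket d y)) = 0"
  proof (cases b)
    case 0
    then show ?thesis using Suc.prems z by simp
  next
    case (Suc b')
    then show ?thesis
      using Suc.hyps(1)[of a b' x "bracket d y"] Suc.prems ab by (simp add: funpow_swap1)
  qed
  finally show ?case by simp
qed

lemma ad_nilpotent_mono:
  assumes "((bracket d) ^^ a) x = 0" "a \<le> b"
  shows "((bracket d) ^^ b) x = 0"
proof -
  have z: "((bracket d) ^^ k) 0 = 0" for k
    by (induction k) auto
  have "((bracket d) ^^ (b - a + a)) x = 0" by (simp only: funpow_add o_def assms(1) z)
  then show ?thesis using assms(2) by simp
qed

text \<open>
  By the weak Leibniz rule the vectors on which \<open>ad d\<close> is nilpotent form a subalgebra.
\<close>

lemma ad_locally_nilpotent: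
  assumes gen: "lie_subalgebra hull S = UNIV"
    and S: "\<And>s. s \<in> S \<Longrightarrow> \<exists>n. ((bracket d) ^^ n) s = 0"
  shows "\<exists>n. ((bracket d) ^^ n) x = 0"
proof -
  let ?N = "{x. \<exists>n. ((bracket d) ^^ n) x = 0}"
  have add: "((bracket d) ^^ k) (u + v) = ((bracket d) ^^ k) u + ((bracket d) ^^ k) v" for k u v
    by (induction k) (auto simp: bracket_add_right)
  have sc: "((bracket d) ^^ k) (scale c u) = scale c (((bracket d) ^^ k) u)" for k c u
    by (induction k) (auto simp: bracket_scale_right)
  have "lie_subalgebra ?N"
    unfolding lie_subalgebra_def subspace_def
  proof (intro conjI ballI allI)
    show "0 \<in> ?N" by (auto intro: exI[of _ 0])
    fix x assume x: "x \<in> ?N"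
    then obtain a where a: "((bracket d) ^^ a) x = 0" by auto
    show "scale c x \<in> ?N" for c using a sc[of a c x] by auto
    fix y assume "y \<in> ?N"
    then obtain b where b: "((bracket d) ^^ b) y = 0" by auto
    show "x + y \<in> ?N"
      using ad_nilpotent_mono[OF a, of "a + b"] ad_nilpotent_mono[OF b, of "a + b"]
      by (auto simp: add intro!: exI[of _ "a + b"])
    show "bracket x y \<in> ?N" using ad_nilpotent_bracket[OF a b] by blast
  qed
  then show ?thesis using subalgebra_hull_minimal[of ?N S] S gen by blast
qed

section \<open>Independence of weight spaces\<close>

definition weight_space :: "'g set \<Rightarrow> ('g \<Rightarrow> 'k) \<Rightarrow> 'g set" where
  "weight_space H \<beta> = {x. \<forall>h\<in>H. bracket h x = scale (\<beta> h) x}"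

lemma subspace_weight_space: "subspace (weight_space H \<beta>)"
  by (auto simp: subspace_def weight_space_def bracket_add_right bracket_scale_right
      scale_right_distrib scale_left_commute)

lemma bracket_weight_space:
  assumes "x \<in> weight_space H \<beta>" "y \<in> weight_space H \<mu>"
  shows "bracket x y \<in> weight_space H (\<beta> + \<mu>)"
  using assms
  by (auto simp: weight_space_def bracket_derivation[of _ x y] bracket_scale_left
      bracket_scale_right scale_left_distrib)

text \<open>
  Applying \<open>ad h - \<kappa>(h)\<close>, with \<open>h\<close> separating \<open>\<kappa>\<close> from another weight of the sum, removes the
  summand of weight \<open>\<kappa>\<close> and only rescales the others.
\<close>

lemma sum_weight_vectors_eq_0:
  assumes "finite F" "F \<subseteq> dual_space scale H"
    "\<And>\<mu>. \<mu> \<in> F \<Longrightarrow> y \<mu> \<in> weight_space H \<mu>" "(\<Sum>\<mu>\<in>F. y \<mu>) = 0" "\<nu> \<in> F"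
  shows "y \<nu> = 0"
  using assms
proof (induction F arbitrary: y \<nu> rule: finite_induct)
  case empty
  then show ?case by simp
next
  case (insert \<kappa> F)
  have vF: "y \<mu> = 0" if "\<mu> \<in> F" for \<mu>
  proof -
    have "\<mu> \<noteq> \<kappa>" using that insert by auto
    moreover have "\<mu> x = 0" "\<kappa> x = 0" if "x \<notin> H" for x
      using insert.prems(1) that \<open>\<mu> \<in> F\<close> by (auto simp: dual_space_def)
    ultimately obtain h where h: "h \<in> H" "\<mu> h \<noteq> \<kappa> h" by (metis ext)
    have b0: "bracket h (\<Sum>\<mu>\<in>F'. g \<mu>) = (\<Sum>\<mu>\<in>F'. bracket h (g \<mu>))" for F' :: "('g \<Rightarrow> 'k) set" and g
      by (induction F' rule: infinite_finite_induct) (auto simp: bracket_add_right)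
    have ev: "bracket h (y \<mu>) = scale (\<mu> h) (y \<mu>)" if "\<mu> \<in> insert \<kappa> F" for \<mu>
      using insert.prems(2)[OF that] h by (simp add: weight_space_def)
    let ?y = "\<lambda>\<mu>. scale (\<mu> h - \<kappa> h) (y \<mu>)"
    have "(\<Sum>\<mu>\<in>insert \<kappa> F. ?y \<mu>) =
        (\<Sum>\<mu>\<in>insert \<kappa> F. bracket h (y \<mu>)) - scale (\<kappa> h) (\<Sum>\<mu>\<in>insert \<kappa> F. y \<mu>)"
      unfolding scale_sum_right sum_subtractf[symmetric]
      by (intro sum.cong refl) (simp add: ev scale_left_diff_distrib)
    then have "(\<Sum>\<mu>\<in>insert \<kappa> F. ?y \<mu>) = 0"
      using insert.prems(3) by (simp add: b0[symmetric] del: sum.insert)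
    then have "(\<Sum>\<mu>\<in>F. ?y \<mu>) = 0" using insert.hyps by simp
    moreover have "?y \<mu> \<in> weight_space H \<mu>" if "\<mu> \<in> F" for \<mu>
      using insert.prems(2) that by (auto intro: subspace_scale subspace_weight_space)
    ultimately have "?y \<mu> = 0"
      using insert.IH[of ?y \<mu>] insert.prems that by simp
    then show ?thesis using h by simp
  qed
  then have "y \<kappa> = 0" using insert.prems(3) insert.hyps by simp
  then show ?case using vF insert.prems by auto
qed

lemma span_weight_spaces_decomposition:
  assumes "x \<in> span (\<Union>\<mu>\<in>S. weight_space H \<mu>)"
  shows "\<exists>F y. finite F \<and> F \<subseteq> S \<and> (\<forall>\<mu>. y \<mu> \<in> weight_space H \<mu>) \<and> (\<forall>\<mu>. \<mu> \<notin> F \<longrightarrow> y \<mu> = 0) \<and>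
    x = (\<Sum>\<mu>\<in>F. y \<mu>)"
  using assms
proof (induction rule: span_induct_alt)
  case base
  show ?case
    by (rule exI[of _ "{}"], rule exI[of _ "\<lambda>_. 0"]) (simp add: subspace_0 subspace_weight_space)
next
  case (step c u v)
  then obtain F y \<kappa> where F: "finite F" "F \<subseteq> S" "\<forall>\<mu>. y \<mu> \<in> weight_space H \<mu>"
    "\<forall>\<mu>. \<mu> \<notin> F \<longrightarrow> y \<mu> = 0" "v = (\<Sum>\<mu>\<in>F. y \<mu>)" and \<kappa>: "\<kappa> \<in> S" "u \<in> weight_space H \<kappa>" by auto
  let ?y = "\<lambda>\<mu>. (if \<mu> = \<kappa> then scale c u else 0) + y \<mu>"
  have "(\<Sum>\<mu>\<in>insert \<kappa> F. ?y \<mu>) = scale c u + (\<Sum>\<mu>\<in>insert \<kappa> F. y \<mu>)"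
    using F(1) by (simp only: sum.distrib) simp
  also have "(\<Sum>\<mu>\<in>insert \<kappa> F. y \<mu>) = v"
    using F by (auto simp: sum.insert_if)
  finally have "scale c u + v = (\<Sum>\<mu>\<in>insert \<kappa> F. ?y \<mu>)" ..
  moreover have "\<forall>\<mu>. ?y \<mu> \<in> weight_space H \<mu>"
    using F(3) \<kappa> by (auto intro!: subspace_add subspace_scale subspace_weight_space)
  moreover have "finite (insert \<kappa> F)" "insert \<kappa> F \<subseteq> S" "\<forall>\<mu>. \<mu> \<notin> insert \<kappa> F \<longrightarrow> ?y \<mu> = 0"
    using F \<kappa> by auto
  ultimately show ?case by (intro exI[of _ "insert \<kappa> F"] exI[of _ ?y] conjI)
qed

text \<open>
  This is how all statements about weights of a subspace are obtained below: exhibit weight vectors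
  that span it and read off their weights.
\<close>

lemma weight_vector_in_span:
  assumes "x \<in> span (\<Union>\<mu>\<in>S. weight_space H \<mu>)" "S \<subseteq> dual_space scale H"
    "x \<in> weight_space H \<beta>" "\<beta> \<in> dual_space scale H" "x \<noteq> 0"
  shows "\<beta> \<in> S"
proof (rule ccontr)
  assume nS: "\<beta> \<notin> S"
  from span_weight_spaces_decomposition[OF assms(1)] obtain F y where
    F: "finite F" "F \<subseteq> S" "\<forall>\<mu>. y \<mu> \<in> weight_space H \<mu>" "x = (\<Sum>\<mu>\<in>F. y \<mu>)" by metis
  define z where "z = y(\<beta> := - x)"
  have nF: "\<beta> \<notin> F" using nS F(2) by blast
  have "z \<mu> = y \<mu>" if "\<mu> \<in> F" for \<mu>
    using that nF by (metis fun_upd_other z_def)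
  then have "(\<Sum>\<mu>\<in>F. z \<mu>) = x" unfolding F(4) by (rule sum.cong[OF refl])
  then have s0: "(\<Sum>\<mu>\<in>insert \<beta> F. z \<mu>) = 0"
    by (simp add: sum.insert[OF F(1) nF]) (simp add: z_def)
  have z: "z \<mu> \<in> weight_space H \<mu>" for \<mu>
    using F(3) assms(3) subspace_neg[OF subspace_weight_space] by (simp add: z_def)
  have "finite (insert \<beta> F)" "insert \<beta> F \<subseteq> dual_space scale H" using F(1,2) assms(2,4) by auto
  from sum_weight_vectors_eq_0[OF this z s0, of \<beta>] have "z \<beta> = 0" by simp
  then show False using assms(5) by (simp add: z_def)
qed

end

section \<open>Triangular decomposition\<close>

definition ad_word :: "('g \<Rightarrow> 'g \<Rightarrow> 'g) \<Rightarrow> ('i \<Rightarrow> 'g) \<Rightarrow> 'i list \<Rightarrow> 'g \<Rightarrow> 'g" where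
  "ad_word br e is x = foldr (\<lambda>i. br (e i)) is x"

lemma ad_word_simps [simp]:
  "ad_word br e [] x = x"
  "ad_word br e (i # is) x = br (e i) (ad_word br e is x)"
  by (simp_all add: ad_word_def)

text \<open>
  The coefficients in terms of the simple roots of the weight of a word in the Chevalley generators.
\<close>

definition letter_count :: "'i list \<Rightarrow> 'i \<Rightarrow> int" where
  "letter_count is i = int (count_list is i)"

lemma letter_count_Nil: "letter_count [] = 0"
  by (auto simp: letter_count_def fun_eq_iff)

lemma letter_count_Cons: "letter_count (i # is) = letter_count is + (\<lambda>j. if j = i then 1 else 0)"
  by (auto simp: letter_count_def fun_eq_iff)

lemma letter_count_nonneg: "0 \<le> letter_count is i"
  by (simp add: letter_count_def)

text \<open>
  The axioms of a Kac--Moody algebra in a form that is symmetric under the exchange of \<open>e\<close> and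
  \<open>f\<close>, with the independence of the simple roots \<open>al i\<close> expressed by their values on \<open>H\<close>.
\<close>

locale triangular_lie_algebra = lie_algebra sc br
  for sc :: "complex \<Rightarrow> 'g::ab_group_add \<Rightarrow> 'g" and br :: "'g \<Rightarrow> 'g \<Rightarrow> 'g" +
  fixes H :: "'g set" and hv :: "'n::finite \<Rightarrow> 'g" and al :: "'n \<Rightarrow> 'g \<Rightarrow> complex"
    and e f :: "'n \<Rightarrow> 'g" and A :: "int^'n^'n"
  assumes subspace_H: "subspace H"
    and hv_in: "hv i \<in> H"
    and al_in: "al i \<in> dual_space sc H"
    and al_independent: "(\<And>h. h \<in> H \<Longrightarrow> (\<Sum>i\<in>UNIV. c i * al i h) = 0) \<Longrightarrow> c i = 0"
    and al_hv: "al j (hv i) = of_int (A $ i $ j)"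
    and H_abelian: "h \<in> H \<Longrightarrow> h' \<in> H \<Longrightarrow> br h h' = 0"
    and br_e_f: "br (e i) (f j) = (if i = j then hv i else 0)"
    and br_h_e: "h \<in> H \<Longrightarrow> br h (e i) = sc (al i h) (e i)"
    and br_h_f: "h \<in> H \<Longrightarrow> br h (f i) = sc (- al i h) (f i)"
    and generated: "lie_subalgebra hull (H \<union> range e \<union> range f) = UNIV"
    and no_ideal: "lie_ideal I \<Longrightarrow> I \<inter> H = {0} \<Longrightarrow> I = {0}"
    and gcm: "generalized_cartan_matrix A"
begin

text \<open>
  The Chevalley involution. Every statement about the \<open>e i\<close> and positive weights yields one about
  the \<open>f i\<close> and negative weights.
\<close>

lemma flip: "triangular_lie_algebra sc br H (\<lambda>i. - hv i) (\<lambda>i. - al i) f e A"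
proof
  show "subspace H" by (rule subspace_H)
  show "- hv i \<in> H" for i using hv_in subspace_neg[OF subspace_H] by blast
  show "- al i \<in> dual_space sc H" for i using al_in[of i] by (simp add: dual_space_def)
  show "c i = 0" if "\<And>h. h \<in> H \<Longrightarrow> (\<Sum>i\<in>UNIV. c i * (- al i) h) = 0" for c i
    using al_independent[of c i] that by (simp add: sum_negf)
  show "(- al j) (- hv i) = of_int (A $ i $ j)" for i j
  proof -
    have "al j (sc (-1) (hv i)) = (-1) * al j (hv i)"
      using al_in[of j] hv_in[of i] unfolding dual_space_def by blast
    then show ?thesis using al_hv by simp
  qed
  show "br (f i) (e j) = (if i = j then - hv i else 0)" for i j
    using bracket_anticomm[of "f i" "e j"] by (simp add: br_e_f)
  show "lie_subalgebra hull (H \<union> range f \<union> range e) = UNIV"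
    using generated by (simp add: Un_ac)
  show "br h h' = 0" if "h \<in> H" "h' \<in> H" for h h' using H_abelian that .
  show "I = {0}" if "lie_ideal I" "I \<inter> H = {0}" for I using no_ideal that .
qed (use br_h_e br_h_f gcm in auto)

definition wt :: "('n \<Rightarrow> int) \<Rightarrow> 'g \<Rightarrow> complex" where
  "wt c = (\<lambda>h. \<Sum>i\<in>UNIV. of_int (c i) * al i h)"

lemma wt_add: "wt (c + d) = wt c + wt d"
  by (simp add: wt_def fun_eq_iff distrib_right sum.distrib)

lemma wt_minus: "wt (- c) = - wt c"
  by (simp add: wt_def fun_eq_iff sum_negf)

lemma wt_zero [simp]: "wt 0 = 0"
  by (simp add: wt_def fun_eq_iff)

lemma wt_unit: "wt (\<lambda>j. if j = i then 1 else 0) = al i"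
  by (simp add: wt_def fun_eq_iff if_distrib if_distribR cong: if_cong)

lemma wt_in: "wt c \<in> dual_space sc H"
proof -
  have d: "al i (x + y) = al i x + al i y" "al i (sc k x) = k * al i x" if "x \<in> H" "y \<in> H" for i x y k
    using al_in[of i] that by (auto simp: dual_space_def)
  have "al i x = 0" if "x \<notin> H" for i x
    using al_in[of i] that by (auto simp: dual_space_def)
  then show ?thesis
    by (auto simp: dual_space_def wt_def d distrib_left sum.distrib sum_distrib_left ac_simps)
qed

lemma wt_inj:
  assumes "wt c = wt d"
  shows "c = d"
proof
  fix i
  have "(\<Sum>i\<in>UNIV. of_int (c i - d i) * al i h) = 0" for h
    using fun_cong[OF assms, of h] by (simp add: wt_def left_diff_distrib sum_subtractf)
  then have "of_int (c i - d i) = (0::complex)"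
    using al_independent[of "\<lambda>i. of_int (c i - d i)" i] by blast
  then show "c i = d i" by simp
qed

lemma wt_hv: "wt c (hv i) = of_int (\<Sum>j\<in>UNIV. A $ i $ j * c j)"
  by (simp add: wt_def al_hv mult.commute)

lemma wt_letter_count_Nil: "wt (letter_count []) = 0"
  by (simp only: letter_count_Nil wt_zero)

lemma wt_letter_count_Cons: "wt (letter_count (i # is)) = al i + wt (letter_count is)"
  by (simp add: letter_count_Cons wt_add wt_unit add.commute)

lemma e_weight: "e i \<in> weight_space H (al i)"
  by (simp add: weight_space_def br_h_e)

lemma f_weight: "f i \<in> weight_space H (- al i)"
  by (simp add: weight_space_def br_h_f)

lemma H_weight: "h \<in> H \<Longrightarrow> h \<in> weight_space H 0"
  by (simp add: weight_space_def H_abelian)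

lemma ad_word_weight:
  assumes "x \<in> weight_space H \<beta>"
  shows "ad_word br e is x \<in> weight_space H (wt (letter_count is) + \<beta>)"
proof (induction "is")
  case Nil
  then show ?case using assms by (simp only: wt_letter_count_Nil ad_word_simps add_0_left)
next
  case (Cons i "is")
  then show ?case
    using bracket_weight_space[OF e_weight[of i] Cons] by (simp only: ad_word_simps wt_letter_count_Cons add.assoc)
qed

definition words :: "'g set" where
  "words = {ad_word br e is (e i) | is i. True}"

lemma e_word_weight: "ad_word br e is (e i) \<in> weight_space H (wt (letter_count (i # is)))"
  using ad_word_weight[OF e_weight[of i], of "is"] by (simp add: wt_letter_count_Cons add.commute)

lemma br_e_span:
  assumes "x \<in> span (H \<union> words)"
  shows "br (e j) x \<in> span words"
proof (rule bracket_span[OF subspace_span _ assms])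
  fix s assume "s \<in> H \<union> words"
  then show "br (e j) s \<in> span words"
  proof
    assume "s \<in> H"
    then have "br (e j) s = sc (- al j s) (ad_word br e [] (e j))"
      using bracket_anticomm[of "e j" s] br_h_e[of s j] by simp
    moreover have "ad_word br e [] (e j) \<in> words" unfolding words_def by blast
    ultimately show ?thesis by (metis span_scale span_base)
  next
    assume "s \<in> words"
    then obtain "is" i where "s = ad_word br e is (e i)" by (auto simp: words_def)
    then have "br (e j) s = ad_word br e (j # is) (e i)" by simp
    then show ?thesis unfolding words_def by (blast intro: span_base)
  qed
qed

text \<open>
  Moving \<open>f k\<close> to the right through a word in the \<open>e i\<close> leaves shorter words and, when it meets
  the last letter, an element of \<open>H\<close>.
\<close>

lemma br_f_word: "br (f k) (ad_word br e is (e i)) \<in> span (H \<union> words)"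
proof (induction "is")
  case Nil
  have "br (f k) (e i) = - (if i = k then hv i else 0)"
    using bracket_anticomm[of "f k" "e i"] br_e_f by simp
  then show ?case using hv_in by (auto intro: span_base span_neg span_zero)
next
  case (Cons j "is")
  let ?w = "ad_word br e is (e i)"
  have "br (f k) (e j) = - (if j = k then hv j else 0)"
    using bracket_anticomm[of "f k" "e j"] br_e_f by simp
  then have "br (f k) (e j) \<in> H" using hv_in subspace_neg[OF subspace_H] subspace_0[OF subspace_H] by auto
  then have "br (br (f k) (e j)) ?w \<in> span (H \<union> words)"
  proof -
    have "?w \<in> span (H \<union> words)" unfolding words_def by (blast intro: span_base)
    then show ?thesis
      using e_word_weight[of "is" i] \<open>br (f k) (e j) \<in> H\<close> by (auto simp: weight_space_def intro: span_scale)
  qed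
  moreover have "br (e j) (br (f k) ?w) \<in> span (H \<union> words)"
    using br_e_span[OF Cons, of j] span_mono[of words "H \<union> words"] by auto
  ultimately show ?case by (simp add: bracket_derivation[of "f k"] span_add)
qed

interpretation opp: triangular_lie_algebra sc br H "\<lambda>i. - hv i" "\<lambda>i. - al i" f e A
  by (rule flip)

lemma opp_wt: "opp.wt c = - wt c"
  by (simp add: opp.wt_def wt_def fun_eq_iff sum_negf)

text \<open>
  The span is an ideal which contains all generators.
\<close>

lemma triangular_decomposition: "span (H \<union> words \<union> opp.words) = UNIV"
proof -
  let ?U = "span (H \<union> words \<union> opp.words)"
  have sub: "span (H \<union> words) \<subseteq> ?U" "span (H \<union> opp.words) \<subseteq> ?U" "span words \<subseteq> ?U" "span opp.words \<subseteq> ?U"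
    by (auto intro!: span_mono)
  have e: "br (e k) u \<in> ?U" if "u \<in> ?U" for k u
  proof (rule bracket_span[OF subspace_span _ that])
    fix s assume "s \<in> H \<union> words \<union> opp.words"
    then consider "s \<in> H \<union> words" | "s \<in> opp.words" by blast
    then show "br (e k) s \<in> ?U"
      using br_e_span[of s k] opp.br_f_word[of k] sub by cases (auto simp: opp.words_def span_base)
  qed
  have f: "br (f k) u \<in> ?U" if "u \<in> ?U" for k u
  proof (rule bracket_span[OF subspace_span _ that])
    fix s assume "s \<in> H \<union> words \<union> opp.words"
    then consider "s \<in> H \<union> opp.words" | "s \<in> words" by blast
    then show "br (f k) s \<in> ?U"
      using opp.br_e_span[of s k] br_f_word[of k] sub by cases (auto simp: words_def span_base)
  qed
  have h: "br h u \<in> ?U" if u: "u \<in> ?U" and h: "h \<in> H" for h u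
  proof (rule bracket_span[OF subspace_span _ u])
    fix s assume s: "s \<in> H \<union> words \<union> opp.words"
    then have "\<exists>\<beta>. s \<in> weight_space H \<beta>"
      using H_weight e_word_weight opp.e_word_weight unfolding words_def opp.words_def by blast
    then obtain c where "br h s = sc c s" using h by (auto simp: weight_space_def)
    then show "br h s \<in> ?U" using s by (auto intro: span_scale span_base)
  qed
  have gens: "H \<union> range e \<union> range f \<subseteq> ?U"
  proof -
    have "e i \<in> words" "f i \<in> opp.words" for i
      unfolding words_def opp.words_def by (auto intro!: exI[of _ "[]"])
    then show ?thesis by (auto intro: span_base)
  qed
  have "lie_ideal ?U"
    by (rule lie_ideal_if_generators[OF generated subspace_span]) (use e f h in blast)
  then have "lie_subalgebra ?U" by (auto simp: lie_ideal_def lie_subalgebra_def)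
  from subalgebra_hull_minimal[OF this gens] show ?thesis using generated by auto
qed

text \<open>
  The words are weight vectors that span the algebra together with \<open>H\<close>, so a non-zero weight is
  among theirs and has coefficients of one sign. That the word does not vanish matters later, where
  it excludes the proper multiples of a simple root.
\<close>

lemma weight_is_word_weight:
  assumes "x \<in> weight_space H \<beta>" "x \<noteq> 0" "\<beta> \<in> dual_space sc H" "\<beta> \<noteq> 0"
  shows "(\<exists>is i. ad_word br e is (e i) \<noteq> 0 \<and> \<beta> = wt (letter_count (i # is))) \<or>
    (\<exists>is i. ad_word br f is (f i) \<noteq> 0 \<and> \<beta> = - wt (letter_count (i # is)))"
proof -
  let ?P = "{wt (letter_count (i # is)) | is i. ad_word br e is (e i) \<noteq> 0}"
  let ?N = "{- wt (letter_count (i # is)) | is i. ad_word br f is (f i) \<noteq> 0}"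
  let ?S = "{0} \<union> ?P \<union> ?N"
  let ?W = "\<Union>\<mu>\<in>?S. weight_space H \<mu>"
  have "ad_word br e is (e i) \<in> span ?W" for "is" i
  proof (cases "ad_word br e is (e i) = 0")
    case False
    then have "ad_word br e is (e i) \<in> ?W" using e_word_weight[of "is" i] by blast
    then show ?thesis by (rule span_base)
  qed (simp add: span_zero)
  moreover have "ad_word br f is (f i) \<in> span ?W" for "is" i
  proof (cases "ad_word br f is (f i) = 0")
    case False
    have "ad_word br f is (f i) \<in> weight_space H (- wt (letter_count (i # is)))"
      using opp.e_word_weight[of "is" i] by (simp add: opp_wt)
    with False have "ad_word br f is (f i) \<in> ?W" by blast
    then show ?thesis by (rule span_base)
  qed (simp add: span_zero)
  moreover have "h \<in> span ?W" if "h \<in> H" for h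
    using H_weight[OF that] by (auto intro!: span_base)
  ultimately have "H \<union> words \<union> opp.words \<subseteq> span ?W"
    unfolding words_def opp.words_def by blast
  then have "x \<in> span ?W" using triangular_decomposition span_minimal[OF _ subspace_span] by blast
  moreover have "?S \<subseteq> dual_space sc H"
    using wt_in opp.wt_in unfolding opp_wt by (auto simp: dual_space_def)
  ultimately have "\<beta> \<in> ?S" using weight_vector_in_span assms by blast
  then show ?thesis using assms(4) by blast
qed

section \<open>Strings of weights\<close>

lemma br_hv_e_power:
  assumes "x \<in> weight_space H \<beta>"
  shows "br (hv i) ((br (e i) ^^ k) x) = sc (\<beta> (hv i) + 2 * of_nat k) ((br (e i) ^^ k) x)"
proof (induction k)
  case 0
  then show ?case using assms hv_in by (simp add: weight_space_def)
next
  case (Suc k)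
  have "A $ i $ i = 2" using gcm by (simp add: generalized_cartan_matrix_def)
  then have "br (hv i) (e i) = sc 2 (e i)" using br_h_e[OF hv_in, of i i] al_hv[of i i] by simp
  then show ?case
    using Suc by (simp add: bracket_derivation[of "hv i"] bracket_scale_left bracket_scale_right
        scale_left_distrib[symmetric])
qed

text \<open>
  The commutation rule of \<open>e\<^sup>r\<close> and \<open>f\<close> in the enveloping algebra of \<open>sl\<^sub>2\<close>, applied to a
  weight vector.
\<close>

lemma e_power_f:
  assumes "x \<in> weight_space H \<beta>"
  shows "(br (e i) ^^ r) (br (f i) x) = br (f i) ((br (e i) ^^ r) x) +
    sc (of_nat r * (\<beta> (hv i) + of_nat r - 1)) ((br (e i) ^^ (r - 1)) x)"
proof (induction r)
  case 0
  then show ?case by simp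
next
  case (Suc r)
  let ?c = "of_nat r * (\<beta> (hv i) + of_nat r - 1)"
  have "br (e i) (sc ?c ((br (e i) ^^ (r - 1)) x)) = sc ?c ((br (e i) ^^ r) x)"
    by (cases r) (simp_all add: bracket_scale_right)
  then have "(br (e i) ^^ Suc r) (br (f i) x) = br (f i) ((br (e i) ^^ Suc r) x) +
      (sc (\<beta> (hv i) + 2 * of_nat r) ((br (e i) ^^ r) x) + sc ?c ((br (e i) ^^ r) x))"
    using Suc br_e_f[of i i] br_hv_e_power[OF assms]
    by (simp add: bracket_add_right bracket_derivation[of "e i" "f i"])
  also have "sc (\<beta> (hv i) + 2 * of_nat r) ((br (e i) ^^ r) x) + sc ?c ((br (e i) ^^ r) x) =
      sc (of_nat (Suc r) * (\<beta> (hv i) + of_nat (Suc r) - 1)) ((br (e i) ^^ (Suc r - 1)) x)"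
    unfolding scale_left_distrib[symmetric] by (simp add: algebra_simps)
  finally show ?case .
qed

lemma f_power_weight:
  assumes "x \<in> weight_space H \<beta>"
  shows "(br (f i) ^^ k) x \<in> weight_space H (\<beta> - fun_scale (of_nat k) (al i))"
proof (induction k)
  case 0
  then show ?case using assms by (simp add: fun_scale_def fun_diff_def)
next
  case (Suc k)
  have "- al i + (\<beta> - fun_scale (of_nat k) (al i)) = \<beta> - fun_scale (of_nat (Suc k)) (al i)"
    by (simp add: fun_eq_iff fun_scale_def algebra_simps)
  then show ?case using bracket_weight_space[OF f_weight[of i] Suc] by (simp only: funpow.simps o_def)
qed

text \<open>
  The \<open>e\<close>-string of \<open>x\<close> ends at \<open>e\<^sup>r x\<close> at the latest. This end can still be reached from
  \<open>f\<^sup>k x\<close>, up to the product over \<open>j < k\<close> of the scalars \<open>(r + j + 1) (m - j + r)\<close>. These do not vanish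
  for \<open>k \<le> m\<close>. The lemma is a substitute for complete reducibility.
\<close>

lemma e_power_f_power:
  assumes x: "x \<in> weight_space H \<beta>" and m: "\<beta> (hv i) = of_nat m"
    and top: "(br (e i) ^^ Suc r) x = 0" and "k \<le> m"
  shows "(\<exists>c. c \<noteq> 0 \<and> (br (e i) ^^ (r + k)) ((br (f i) ^^ k) x) = sc c ((br (e i) ^^ r) x)) \<and>
    (br (e i) ^^ Suc (r + k)) ((br (f i) ^^ k) x) = 0"
  using \<open>k \<le> m\<close>
proof (induction k)
  case 0
  then show ?case using top by (auto intro: exI[of _ 1])
next
  case (Suc k)
  let ?y = "(br (f i) ^^ k) x" and ?b = "\<beta> - fun_scale (of_nat k) (al i)"
  from Suc obtain c where c: "c \<noteq> 0" "(br (e i) ^^ (r + k)) ?y = sc c ((br (e i) ^^ r) x)"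
    and z: "(br (e i) ^^ Suc (r + k)) ?y = 0" by auto
  have y: "?y \<in> weight_space H ?b" using f_power_weight[OF x] .
  have "A $ i $ i = 2" using gcm by (simp add: generalized_cartan_matrix_def)
  then have b: "?b (hv i) = of_nat m - 2 * of_nat k" by (simp add: fun_scale_def m al_hv)
  let ?d = "of_nat (Suc (r + k)) * (?b (hv i) + of_nat (Suc (r + k)) - 1)"
  from Suc.prems obtain l where l: "m = Suc k + l" using le_Suc_ex by blast
  have "?d = of_nat (Suc (r + k) * Suc (l + r))"
    unfolding b l by (simp add: algebra_simps)
  then have "?d \<noteq> 0" by (simp del: of_nat_add of_nat_Suc of_nat_mult)
  moreover have "(br (e i) ^^ Suc (r + k)) (br (f i) ?y) = sc (?d * c) ((br (e i) ^^ r) x)"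
    using e_power_f[OF y, of "Suc (r + k)" i] z c(2) by simp
  moreover have "(br (e i) ^^ Suc (Suc (r + k))) (br (f i) ?y) = 0"
    using e_power_f[OF y, of "Suc (Suc (r + k))" i] z by simp
  ultimately show ?case using c(1) by (auto intro!: exI[of _ "?d * c"])
qed

text \<open>
  Hence the weight string through \<open>\<beta>\<close> extends at least down to the reflection of \<open>\<beta>\<close>: this is the
  invariance of the set of roots under simple reflections, in the only direction that is used.
\<close>

lemma f_power_nonzero:
  assumes x: "x \<in> weight_space H \<beta>" "x \<noteq> 0" and m: "\<beta> (hv i) = of_nat m"
    and nil: "(br (e i) ^^ n) x = 0"
  shows "(br (f i) ^^ m) x \<noteq> 0"
proof
  assume 0: "(br (f i) ^^ m) x = 0"
  define r where "r = (LEAST n. (br (e i) ^^ n) x = 0)"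
  have r0: "(br (e i) ^^ r) x = 0" unfolding r_def by (rule LeastI, rule nil)
  then obtain r' where r': "r = Suc r'" using x(2) by (cases r) auto
  have "(br (e i) ^^ r') x \<noteq> 0" using r' not_less_Least[of r' "\<lambda>n. (br (e i) ^^ n) x = 0"] unfolding r_def by auto
  moreover obtain c where "c \<noteq> 0" "(br (e i) ^^ (r' + m)) ((br (f i) ^^ m) x) = sc c ((br (e i) ^^ r') x)"
    using e_power_f_power[OF x(1) m, of r' m] r0 r' by auto
  moreover have "(br (e i) ^^ k) 0 = 0" for k by (induction k) auto
  ultimately show False using 0 by simp
qed

text \<open>
  A vector of positive weight that is killed by all \<open>f k\<close> generates, under the \<open>e i\<close> alone, an ideal
  all of whose weights are positive; this ideal meets \<open>H\<close> only in zero.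
\<close>

lemma lowest_weight_vector_eq_0:
  assumes x: "x \<in> weight_space H (wt c)" and c: "\<And>i. 0 \<le> c i" "c \<noteq> 0"
    and low: "\<And>k. br (f k) x = 0"
  shows "x = 0"
proof -
  let ?B = "{ad_word br e is x | is. True}"
  let ?W = "span ?B"
  have sW: "subspace ?W" by (rule subspace_span)
  have B: "ad_word br e is x \<in> ?W" for "is" by (auto intro: span_base)
  have e: "br (e k) u \<in> ?W" if "u \<in> ?W" for k u
  proof (rule bracket_span[OF sW _ that])
    fix s assume "s \<in> ?B"
    then obtain "is" where "br (e k) s = ad_word br e (k # is) x" by auto
    then show "br (e k) s \<in> ?W" using B by metis
  qed
  have h_word: "br h (ad_word br e is x) \<in> ?W" if "h \<in> H" for h "is"
    using ad_word_weight[OF x, of "is"] that B[of "is"] by (auto simp: weight_space_def intro: span_scale)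
  have h: "br h u \<in> ?W" if "u \<in> ?W" "h \<in> H" for h u
    by (rule bracket_span[OF sW _ that(1)]) (use h_word that(2) in auto)
  have f_word: "br (f k) (ad_word br e is x) \<in> ?W" for k "is"
  proof (induction "is")
    case Nil
    then show ?case using low by (simp add: span_zero)
  next
    case (Cons j "is")
    have "br (f k) (e j) = - (if j = k then hv j else 0)"
      using bracket_anticomm[of "f k" "e j"] br_e_f by simp
    then have "br (f k) (e j) \<in> H" using hv_in subspace_neg[OF subspace_H] subspace_0[OF subspace_H] by auto
    then have "br (br (f k) (e j)) (ad_word br e is x) \<in> ?W" by (rule h_word)
    then show ?case using e[OF Cons, of j] by (simp add: bracket_derivation[of "f k"] span_add)
  qed
  have f: "br (f k) u \<in> ?W" if "u \<in> ?W" for k u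
    by (rule bracket_span[OF sW _ that]) (use f_word in auto)
  have "lie_ideal ?W"
    by (rule lie_ideal_if_generators[OF generated sW]) (use e f h in blast)
  moreover have "y = 0" if y: "y \<in> ?W" "y \<in> H" for y
  proof (rule ccontr)
    assume "y \<noteq> 0"
    let ?S = "{wt d | d. (\<forall>i. 0 \<le> d i) \<and> d \<noteq> 0}"
    have "?B \<subseteq> (\<Union>\<mu>\<in>?S. weight_space H \<mu>)"
    proof
      fix s assume "s \<in> ?B"
      then obtain "is" where s: "s = ad_word br e is x" by auto
      have "letter_count is + c \<noteq> 0"
      proof
        assume *: "letter_count is + c = 0"
        have "c i = 0" for i
          using fun_cong[OF *, of i] c(1)[of i] letter_count_nonneg[of "is" i] by simp
        then show False using c(2) by (simp add: fun_eq_iff)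
      qed
      moreover have "s \<in> weight_space H (wt (letter_count is + c))"
        using ad_word_weight[OF x, of "is"] s by (simp only: wt_add)
      moreover have "\<forall>i. 0 \<le> (letter_count is + c) i" by (simp add: c(1) letter_count_nonneg add_nonneg_nonneg)
      ultimately show "s \<in> (\<Union>\<mu>\<in>?S. weight_space H \<mu>)" by blast
    qed
    then have "y \<in> span (\<Union>\<mu>\<in>?S. weight_space H \<mu>)" using span_mono y(1) by blast
    moreover have "?S \<subseteq> dual_space sc H" using wt_in by blast
    moreover have "0 \<in> dual_space sc H" using wt_in[of 0] by (simp only: wt_zero)
    ultimately have "0 \<in> ?S" using weight_vector_in_span H_weight[OF y(2)] \<open>y \<noteq> 0\<close> by blast
    then obtain d where "wt d = wt 0" "d \<noteq> 0" using wt_zero by auto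
    then show False using wt_inj by blast
  qed
  ultimately have "?W = {0}"
    using no_ideal[of ?W] subspace_0[OF sW] subspace_0[OF subspace_H] by blast
  then show "x = 0" using B[of "[]"] by simp
qed

lemma br_e_H: "h \<in> H \<Longrightarrow> br (e i) h = sc (- al i h) (e i)"
  using bracket_anticomm[of "e i" h] br_h_e[of h i] by simp

text \<open>
  The left-hand side has positive weight, so it suffices that all \<open>f k\<close> kill it. For \<open>k = i\<close> the
  exponent makes the scalar in the commutation rule vanish; for \<open>k = j\<close> one is left with powers of
  \<open>ad (e i)\<close> on \<open>hv j\<close>, which vanish because \<open>[e i, e i] = 0\<close>, or because \<open>A $ j $ i = 0\<close> if the exponent is one.
\<close>

lemma serre_relation:
  assumes "i \<noteq> j"
  shows "(br (e i) ^^ nat (1 - A $ i $ j)) (e j) = 0"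
proof -
  let ?n = "nat (1 - A $ i $ j)"
  have neg: "A $ i $ j \<le> 0" using gcm assms by (auto simp: generalized_cartan_matrix_def)
  have pow: "(br (e i) ^^ n) x = ad_word br e (replicate n i) x" for n x
    by (induction n) auto
  have zero: "(br (e i) ^^ n) 0 = 0" for n by (induction n) auto
  have comm: "br (f k) ((br (e i) ^^ n) x) = (br (e i) ^^ n) (br (f k) x)" if "k \<noteq> i" for k n x
  proof (induction n)
    case (Suc n)
    have "br (f k) (e i) = 0" using bracket_anticomm[of "f k" "e i"] br_e_f that by auto
    then show ?case using Suc by (simp add: bracket_derivation[of "f k"])
  qed simp
  have fe: "br (f k) (e j) = - (if j = k then hv j else 0)" for k
    using bracket_anticomm[of "f k" "e j"] br_e_f by simp
  show ?thesis
  proof (rule lowest_weight_vector_eq_0)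
    show "(br (e i) ^^ ?n) (e j) \<in> weight_space H (wt (letter_count (j # replicate ?n i)))"
      unfolding pow by (rule e_word_weight)
    show "0 \<le> letter_count (j # replicate ?n i) k" for k by (rule letter_count_nonneg)
    show "letter_count (j # replicate ?n i) \<noteq> 0"
      by (auto simp: letter_count_def fun_eq_iff intro!: exI[of _ j])
    fix k
    consider "k = i" | "k \<noteq> i" "k \<noteq> j" | "k \<noteq> i" "k = j" by blast
    then show "br (f k) ((br (e i) ^^ ?n) (e j)) = 0"
    proof cases
      case 1
      have "of_nat ?n = (1 - of_int (A $ i $ j) :: complex)"
        using neg by (simp add: of_nat_nat)
      then have "al j (hv i) + of_nat ?n - 1 = 0" by (simp add: al_hv)
      then show ?thesis using e_power_f[OF e_weight[of j], of ?n i] fe[of i] assms 1 zero by simp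
    next
      case 2
      then show ?thesis using comm[OF 2(1)] fe[of k] zero by simp
    next
      case 3
      have "br (f k) ((br (e i) ^^ ?n) (e j)) = (br (e i) ^^ ?n) (- hv j)"
        using comm[OF 3(1)] fe[of k] 3 by simp
      also obtain p where p: "?n = Suc p" using neg by (cases ?n) auto
      have eh: "br (e i) (- hv j) = sc (of_int (A $ j $ i)) (e i)"
        using br_e_H[OF hv_in, of i j] by (simp add: al_hv bracket_minus_right)
      have "(br (e i) ^^ ?n) (- hv j) = (br (e i) ^^ p) (sc (of_int (A $ j $ i)) (e i))"
        unfolding p funpow_Suc_right o_def eh ..
      also have "\<dots> = 0"
      proof (cases p)
        case 0
        then have "A $ i $ j = 0" using p neg by simp
        then have "A $ j $ i = 0" using gcm by (auto simp: generalized_cartan_matrix_def)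
        then show ?thesis using 0 by simp
      next
        case (Suc q)
        have "br (e i) (sc (of_int (A $ j $ i)) (e i)) = 0" by (simp add: bracket_scale_right bracket_self)
        then show ?thesis using zero unfolding Suc funpow_Suc_right o_def by simp
      qed
      finally show ?thesis .
    qed
  qed
qed

lemma e_locally_nilpotent: "\<exists>n. (br (e i) ^^ n) x = 0"
proof (rule ad_locally_nilpotent[OF generated])
  fix s assume "s \<in> H \<union> range e \<union> range f"
  then consider "s \<in> H" | j where "s = e j" | j where "s = f j" by blast
  then show "\<exists>n. (br (e i) ^^ n) s = 0"
  proof cases
    case 1
    then have "(br (e i) ^^ 2) s = 0"
      by (simp add: numeral_2_eq_2 br_e_H bracket_scale_right bracket_minus_right bracket_self)
    then show ?thesis by blast
  next
    case 2
    show ?thesis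
    proof (cases "i = j")
      case True
      then have "(br (e i) ^^ 1) s = 0" using 2 by (simp add: bracket_self)
      then show ?thesis by blast
    next
      case False
      then show ?thesis using serre_relation 2 by blast
    qed
  next
    case 3
    have "(br (e i) ^^ 3) s = 0"
      using 3 br_e_f[of i j] br_e_H[OF hv_in, of j j]
      by (cases "i = j") (simp_all add: numeral_3_eq_3 bracket_scale_right bracket_minus_right bracket_self)
    then show ?thesis by blast
  qed
qed

lemma word_in_one_letter_eq_0:
  assumes "set is \<subseteq> {i}" "is \<noteq> []"
  shows "ad_word br e is (e i) = 0"
  using assms
proof (induction "is")
  case (Cons j js)
  then show ?case by (cases "js = []") (auto simp: bracket_self)
qed simp

end

section \<open>Integer vectors in the kernel of an affine matrix\<close>

lemma affine_nonpos_imp_zero: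
  fixes A :: "int^'n^'n" and c :: "'n \<Rightarrow> int"
  assumes "affine_type A" "\<And>i. (\<Sum>j\<in>UNIV. A $ i $ j * c j) \<le> 0"
  shows "(\<Sum>j\<in>UNIV. A $ i $ j * c j) = 0"
proof -
  let ?M = "map_matrix real_of_int A" and ?v = "\<chi> i. - real_of_int (c i)"
  have M: "(?M *v ?v) $ i = - real_of_int (\<Sum>j\<in>UNIV. A $ i $ j * c j)" for i
    by (simp add: matrix_vector_mult_def map_matrix_def sum_negf)
  have "\<forall>i. (?M *v ?v) $ i \<ge> 0"
  proof
    fix i show "(?M *v ?v) $ i \<ge> 0" unfolding M using assms(2)[of i] by linarith
  qed
  then have "?M *v ?v = 0" using assms(1) unfolding affine_type_def Let_def by blast
  then show ?thesis using M[of i] by (simp del: of_int_sum of_int_mult)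
qed

text \<open>
  The kernel of a matrix of corank one is a line.
\<close>

lemma affine_kernel_proportional:
  fixes A :: "int^'n^'n" and c d :: "'n \<Rightarrow> int"
  assumes "affine_type A" "\<And>i. (\<Sum>j\<in>UNIV. A $ i $ j * c j) = 0" "\<And>i. (\<Sum>j\<in>UNIV. A $ i $ j * d j) = 0"
  shows "c i * d j = d i * c j"
proof -
  let ?M = "map_matrix real_of_int A"
  let ?K = "{v. ?M *v v = 0}"
  define v where "v = (\<lambda>c::'n \<Rightarrow> int. (\<chi> i. real_of_int (c i)) :: real^'n)"
  have M: "(?M *v v c) $ i = real_of_int (\<Sum>j\<in>UNIV. A $ i $ j * c j)" for i c
    by (simp add: matrix_vector_mult_def map_matrix_def v_def)
  have cd: "v c \<in> ?K" "v d \<in> ?K" using M assms(2,3) by (simp_all add: vec_eq_iff del: of_int_sum of_int_mult)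
  have sK: "subspace ?K"
    by (simp add: subspace_def matrix_vector_right_distrib matrix_vector_mult_scaleR)
  have rows: "rows ?M = range (\<lambda>i. ?M $ i)"
    by (auto simp: rows_def row_def vec_eq_iff)
  have "?K = {y. \<forall>x\<in>rows ?M. orthogonal x y}"
    using rows by (auto simp: vec_eq_iff matrix_vector_mul_component orthogonal_def)
  also have "\<dots> = {y \<in> UNIV. \<forall>x\<in>span (rows ?M). orthogonal x y}"
  proof -
    have "orthogonal x y" if "\<forall>z\<in>rows ?M. orthogonal z y" "x \<in> span (rows ?M)" for x y
      using orthogonal_to_span[OF that(2), of y] that(1) by (simp add: orthogonal_commute)
    then show ?thesis by (auto intro: span_base)
  qed
  finally have "dim ?K + dim (rows ?M) = dim (UNIV :: (real^'n) set)"
    using dim_subspace_orthogonal_to_vectors[of "span (rows ?M)" UNIV] by simp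
  then have dK: "dim ?K = 1"
    using assms(1) by (simp add: affine_type_def Let_def row_rank_def)
  show ?thesis
  proof (cases "v c = 0")
    case True
    then have "c = (\<lambda>_. 0)" by (auto simp: v_def vec_eq_iff)
    then show ?thesis by simp
  next
    case False
    have "span {v c} = ?K"
    proof (rule subspace_dim_equal)
      show "subspace (span {v c})" by simp
      show "subspace ?K" by (rule sK)
      show "span {v c} \<subseteq> ?K" using cd(1) sK by (intro span_minimal) auto
      show "dim ?K \<le> dim (span {v c})" using dK False by simp
    qed
    then obtain r where "v d = r *\<^sub>R v c" using cd(2) by (auto simp: span_singleton)
    then have "real_of_int (d k) = r * real_of_int (c k)" for k by (simp add: v_def vec_eq_iff)
    then have "real_of_int (c i * d j) = real_of_int (d i * c j)" by simp
    then show ?thesis by (simp only: of_int_eq_iff)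
  qed
qed

text \<open>
  Reflecting twice shows that \<open>T\<close> is invariant under translation by \<open>2 p\<close> and \<open>2 q\<close>, hence by \<open>2\<close>, since
  \<open>p\<close> and \<open>q\<close> are coprime. So \<open>T\<close> is a union of parity classes, and \<open>p + q\<close> has the parity of one
  of \<open>0\<close>, \<open>p\<close>, \<open>q\<close>.
\<close>

lemma int_reflection_closed_sum:
  fixes T :: "int set"
  assumes T: "0 \<in> T" "p \<in> T" "q \<in> T" and refl: "\<And>m n. m \<in> T \<Longrightarrow> n \<in> T \<Longrightarrow> 2 * m - n \<in> T"
    and "coprime p q"
  shows "p + q \<in> T"
proof -
  have neg: "- t \<in> T" if "t \<in> T" for t using refl[OF T(1) that] by simp
  have step: "t + 2 * s \<in> T" if "t \<in> T" "s \<in> T" for s t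
    using refl[OF that(2) neg[OF that(1)]] by (simp add: add.commute)
  have mult: "t + 2 * (s * k) \<in> T" if "t \<in> T" "s \<in> T" for s t k
  proof (induction k rule: int_induct[where k = 0])
    case (step1 i)
    then show ?case using step[of "t + 2 * (s * i)" s] that by (simp add: algebra_simps)
  next
    case (step2 i)
    then show ?case using step[of "t + 2 * (s * i)" "- s"] that neg by (simp add: algebra_simps)
  qed (use that in simp)
  obtain u v where uv: "u * p + v * q = 1"
    using bezout_int[of p q] \<open>coprime p q\<close> by (metis coprime_imp_gcd_eq_1)
  have even: "t + 2 * k \<in> T" if "t \<in> T" for t k
  proof -
    have "t + 2 * (p * (u * k)) + 2 * (q * (v * k)) \<in> T" using mult that T by blast
    also have "t + 2 * (p * (u * k)) + 2 * (q * (v * k)) = t + 2 * ((u * p + v * q) * k)"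
      by (simp add: algebra_simps)
    finally show ?thesis using uv by simp
  qed
  consider l where "p = 2 * l" | l where "q = 2 * l" | l where "p + q = 2 * l"
    by (metis evenE odd_even_add)
  then show ?thesis
  proof cases
    case 1
    then show ?thesis using even[OF T(3), of l] by (simp add: add.commute)
  next
    case 2
    then show ?thesis using even[OF T(2), of l] by simp
  next
    case 3
    then show ?thesis using even[OF T(1), of l] by simp
  qed
qed

section \<open>Imaginary roots lie in the kernel\<close>

context triangular_lie_algebra
begin

text \<open>
  Descent on the height. Here \<open>P\<close> stands for the set of functionals whose orbit under the Weyl group
  contains a simple root. If some coroot \<open>hv i\<close> is positive on a positive weight outside \<open>P\<close>, then the
  reflected functional is again a positive weight outside \<open>P\<close>, of smaller height. By induction it lies
  in the kernel, so it is fixed by the reflection, which is absurd. If no coroot is positive on the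
  weight, then the affine type of \<open>A\<close> forces all its values on coroots to be zero.
\<close>

lemma positive_weight_in_kernel:
  assumes aff: "affine_type A"
    and P: "\<And>i. al i \<in> P"
      "\<And>i \<beta>. \<beta> \<in> dual_space sc H \<Longrightarrow> \<beta> - fun_scale (\<beta> (hv i)) (al i) \<in> P \<Longrightarrow> \<beta> \<in> P"
    and c: "\<And>i. 0 \<le> c i" "c \<noteq> 0" "wt c \<notin> P"
    and x: "x \<in> weight_space H (wt c)" "x \<noteq> 0"
  shows "(\<Sum>j\<in>UNIV. A $ i $ j * c j) = 0"
  using c x
proof (induction "nat (\<Sum>j\<in>UNIV. c j)" arbitrary: c x i rule: less_induct)
  case less
  let ?m = "\<lambda>i. \<Sum>j\<in>UNIV. A $ i $ j * c j"
  have word: "\<exists>k is. ad_word br e is (e k) \<noteq> 0 \<and> d = letter_count (k # is)"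
    if y: "y \<in> weight_space H (wt d)" "y \<noteq> 0" and j: "0 < d j" for d y j
  proof -
    have "d \<noteq> 0" using j by auto
    then have "wt d \<noteq> 0" using wt_inj[of d 0] wt_zero by metis
    from weight_is_word_weight[OF y wt_in this] show ?thesis
    proof
      assume "\<exists>is i. ad_word br f is (f i) \<noteq> 0 \<and> wt d = - wt (letter_count (i # is))"
      then obtain "is" i where "wt d = wt (- letter_count (i # is))" unfolding wt_minus by blast
      then have "d j = - letter_count (i # is) j" using wt_inj by (metis fun_Compl_def)
      then show ?thesis using j letter_count_nonneg[of "i # is" j] by simp
    qed (metis wt_inj)
  qed
  have "?m i \<le> 0" for i
  proof (rule ccontr)
    assume pos: "\<not> ?m i \<le> 0"
    \<comment> \<open>A word in a single letter vanishes unless it has length one, so a weight concentrated at \<open>i\<close> is simple.\<close>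
    have other: "\<exists>j. j \<noteq> i \<and> 0 < c j"
    proof (rule ccontr)
      assume "\<not> ?thesis"
      then have sup: "c j = 0" if "j \<noteq> i" for j using less.prems(1)[of j] that by force
      obtain j0 where "c j0 \<noteq> 0" using less.prems(2) by (auto simp: fun_eq_iff)
      then have "0 < c j0" using less.prems(1)[of j0] by simp
      from word[where d = c and j = j0, OF less.prems(4,5) this] obtain k "is" where k: "ad_word br e is (e k) \<noteq> 0" "c = letter_count (k # is)" by blast
      have "count_list (k # is) j = 0" if "j \<noteq> i" for j
        using sup[OF that] unfolding k(2) letter_count_def by simp
      then have "set (k # is) \<subseteq> {i}" by (metis count_list_0_iff singleton_iff subsetI)
      then have "k = i" "is = []" using word_in_one_letter_eq_0[of "is" i] k(1) by auto
      then have "wt c = al i" using k(2) wt_letter_count_Cons[of i "[]"] by (simp only: wt_letter_count_Nil add_0_right)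
      then show False using P(1)[of i] less.prems(3) by simp
    qed
    then obtain j where j: "j \<noteq> i" "0 < c j" by blast
    \<comment> \<open>The reflected weight. It is positive because its coefficient at some \<open>j \<noteq> i\<close> has not changed.\<close>
    define d where "d = (\<lambda>k. c k - (if k = i then ?m i else 0))"
    have wd: "wt d = wt c - fun_scale (wt c (hv i)) (al i)"
    proof -
      have "of_int (d k) * al k h =
          of_int (c k) * al k h - (if k = i then of_int (?m i) * al i h else 0)" for k h
        by (simp add: d_def left_diff_distrib)
      then show ?thesis
        unfolding wt_hv by (simp add: fun_eq_iff wt_def fun_scale_def sum_subtractf del: of_int_sum)
    qed
    have m: "wt c (hv i) = of_nat (nat (?m i))"
      using pos by (simp add: wt_hv of_nat_nat del: of_int_sum)
    obtain n where n: "(br (e i) ^^ n) x = 0" using e_locally_nilpotent by blast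
    let ?y = "(br (f i) ^^ nat (?m i)) x"
    have y: "?y \<in> weight_space H (wt d)" "?y \<noteq> 0"
      using f_power_weight[OF less.prems(4), of "nat (?m i)" i] f_power_nonzero[OF less.prems(4,5) m n]
      unfolding wd m by auto
    have dj: "0 < d j" using j by (simp add: d_def)
    from word[OF y this] have dpos: "0 \<le> d k" for k using letter_count_nonneg by metis
    have sd: "(\<Sum>k\<in>UNIV. d k) = (\<Sum>k\<in>UNIV. c k) - ?m i"
      by (simp add: d_def sum_subtractf)
    have "0 \<le> (\<Sum>k\<in>UNIV. d k)" by (intro sum_nonneg dpos)
    then have lt: "nat (\<Sum>k\<in>UNIV. d k) < nat (\<Sum>k\<in>UNIV. c k)" using sd pos by linarith
    have "d \<noteq> 0" using dj by auto
    moreover have "wt d \<notin> P" using P(2)[OF wt_in, of c i] less.prems(3) unfolding wd by blast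
    ultimately have 0: "(\<Sum>j\<in>UNIV. A $ i $ j * d j) = 0"
      using less.hyps[OF lt dpos _ _ y] by blast
    have "A $ i $ i = 2" using gcm by (simp add: generalized_cartan_matrix_def)
    then have "A $ i $ j * d j = A $ i $ j * c j - (if j = i then 2 * ?m i else 0)" for j
      by (simp add: d_def right_diff_distrib)
    then have "(\<Sum>j\<in>UNIV. A $ i $ j * d j) = ?m i - 2 * ?m i"
      by (simp add: sum_subtractf)
    then show False using 0 pos by simp
  qed
  then show ?case by (rule affine_nonpos_imp_zero[OF aff])
qed

end

section \<open>Real roots, imaginary roots and the invariant form\<close>

lemma vector_space_fun_scale: "vector_space (fun_scale :: 'k::field \<Rightarrow> ('g \<Rightarrow> 'k) \<Rightarrow> 'g \<Rightarrow> 'k)"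
  by unfold_locales (auto simp: fun_scale_def fun_eq_iff algebra_simps)

lemma (in kac_moody_algebra) triangular:
  assumes "generalized_cartan_matrix A"
  shows "triangular_lie_algebra (smult G) (bracket G) (cartan G) (coroot G) (simple_root G)
    (chev_e G) (chev_f G) A"
proof
  show "c i = 0" if c: "\<And>h. h \<in> cartan G \<Longrightarrow> (\<Sum>i\<in>UNIV. c i * simple_root G i h) = 0" for c i
  proof -
    interpret dual: vector_space "fun_scale :: complex \<Rightarrow> ('a \<Rightarrow> complex) \<Rightarrow> 'a \<Rightarrow> complex"
      by (rule vector_space_fun_scale)
    let ?u = "\<lambda>v. c (inv (simple_root G) v)"
    have "(\<Sum>v\<in>range (simple_root G). fun_scale (?u v) v) = (\<Sum>i\<in>UNIV. fun_scale (c i) (simple_root G i))"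
      using simple_root_indep(1) by (simp add: sum.reindex)
    also have "\<dots> = 0"
    proof
      fix h
      have "(\<Sum>i\<in>S. fun_scale (c i) (simple_root G i)) h = (\<Sum>i\<in>S. c i * simple_root G i h)" for S
        by (induction S rule: infinite_finite_induct) (auto simp: fun_scale_def)
      moreover have "simple_root G i h = 0" if "h \<notin> cartan G" for i
        using simple_root_in[of i] that by (simp add: dual_space_def)
      ultimately show "(\<Sum>i\<in>UNIV. fun_scale (c i) (simple_root G i)) h = 0 h"
        using c[of h] by (cases "h \<in> cartan G") auto
    qed
    finally have "?u (simple_root G i) = 0"
      using dual.independentD[OF simple_root_indep(2), of "range (simple_root G)" ?u "simple_root G i"]
      by simp
    then show ?thesis using simple_root_indep(1) by simp
  qed
qed (use cartan_subspace coroot_in simple_root_in simple_root_coroot cartan_abelian bracket_e_f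
    bracket_h_e bracket_h_f generated no_ideal assms in auto)

locale affine_kac_moody_with_form = kac_moody_algebra G A
  for G :: "('g::ab_group_add, 'n::finite) km_data" and A :: "int^'n^'n" +
  fixes B :: "('g \<Rightarrow> complex) \<Rightarrow> ('g \<Rightarrow> complex) \<Rightarrow> complex"
  assumes affine: "affine_cartan_matrix A" and form: "standard_form G B"
begin

sublocale tri: triangular_lie_algebra "smult G" "bracket G" "cartan G" "coroot G" "simple_root G"
  "chev_e G" "chev_f G" A
  using affine by (intro triangular) (simp add: affine_cartan_matrix_def)

lemma aff: "affine_type A"
  using affine by (simp add: affine_cartan_matrix_def)

lemma root_space_eq: "root_space G \<beta> = weight_space (cartan G) \<beta>"
  by (simp add: root_space_def weight_space_def)

definition in_kernel :: "('n \<Rightarrow> int) \<Rightarrow> bool" where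
  "in_kernel c \<longleftrightarrow> (\<forall>i. (\<Sum>j\<in>UNIV. A $ i $ j * c j) = 0)"

lemma root_is_wt: "\<beta> \<in> roots G \<Longrightarrow> \<exists>c. \<beta> = tri.wt c"
proof -
  assume \<beta>: "\<beta> \<in> roots G"
  then obtain x where x: "x \<in> weight_space (cartan G) \<beta>" "x \<noteq> 0"
    using subspace_0[OF subspace_weight_space] by (auto simp: roots_def root_space_eq)
  show ?thesis
    using tri.weight_is_word_weight[OF x] \<beta> tri.wt_minus[symmetric]
    by (auto simp: roots_def cartan_dual_def)
qed

lemma weyl_group_comp_simple_reflection:
  "w \<in> weyl_group G \<Longrightarrow> w \<circ> simple_reflection G i \<in> weyl_group G"
proof (induction rule: weyl_group.induct)
  case 1
  then show ?case using weyl_group.intros(2)[OF weyl_group.intros(1), of G i] by simp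
next
  case (2 w j)
  then show ?case using weyl_group.intros(2)[OF 2(2), of j] by (simp only: comp_assoc)
qed

text \<open>
  The descent applies to the positive roots, and through the Chevalley involution to the negative ones.
\<close>

lemma nonreal_root_in_kernel:
  assumes \<beta>: "\<beta> \<in> roots G" "\<beta> \<notin> real_roots G"
  shows "\<exists>c. \<beta> = tri.wt c \<and> in_kernel c"
proof -
  interpret opp: triangular_lie_algebra "smult G" "bracket G" "cartan G" "\<lambda>i. - coroot G i"
    "\<lambda>i. - simple_root G i" "chev_f G" "chev_e G" A
    by (rule tri.flip)
  define P where "P = {\<beta>. \<exists>w\<in>weyl_group G. \<exists>i. w \<beta> = simple_root G i}"
  have nP: "\<beta> \<notin> P" using \<beta> by (simp add: real_roots_def P_def)
  from \<beta> obtain x where x: "x \<in> weight_space (cartan G) \<beta>" "x \<noteq> 0"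
    using subspace_0[OF subspace_weight_space] by (auto simp: roots_def root_space_eq)
  have al: "simple_root G i \<in> P" for i using weyl_group.intros(1)[of G] by (auto simp: P_def intro!: bexI[of _ id])
  have refl: "\<gamma> \<in> P" if P: "\<gamma> - fun_scale (\<gamma> (coroot G i)) (simple_root G i) \<in> P" for \<gamma> i
  proof -
    obtain w k where w: "w \<in> weyl_group G" "w (simple_reflection G i \<gamma>) = simple_root G k"
      using P by (auto simp: P_def simple_reflection_def)
    then have "(w \<circ> simple_reflection G i) \<gamma> = simple_root G k" by simp
    then show ?thesis using weyl_group_comp_simple_reflection[OF w(1)] unfolding P_def by blast
  qed
  have Aii: "A $ i $ i = 2" for i
    using affine by (simp add: affine_cartan_matrix_def generalized_cartan_matrix_def)
  have neg: "- simple_root G i \<in> P" for i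
  proof (rule refl[of _ i])
    have "- simple_root G i - fun_scale ((- simple_root G i) (coroot G i)) (simple_root G i) = simple_root G i"
      by (simp add: fun_eq_iff fun_scale_def simple_root_coroot Aii)
    then show "- simple_root G i - fun_scale ((- simple_root G i) (coroot G i)) (simple_root G i) \<in> P"
      by (simp only: al)
  qed
  have letters: "0 \<le> letter_count is k" "letter_count (i # is) \<noteq> 0" for "is" i k
    by (auto simp: letter_count_def fun_eq_iff intro!: exI[of _ i])
  have "\<beta> \<in> dual_space (smult G) (cartan G)" "\<beta> \<noteq> 0" using \<beta> by (auto simp: roots_def cartan_dual_def)
  from tri.weight_is_word_weight[OF x this] show ?thesis
  proof (elim disjE exE conjE)
    fix "is" i assume b: "\<beta> = tri.wt (letter_count (i # is))"
    have "(\<Sum>l\<in>UNIV. A $ k $ l * letter_count (i # is) l) = 0" for k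
      by (rule tri.positive_weight_in_kernel[OF aff _ _ _ _ nP[unfolded b] x(1)[unfolded b] x(2)])
        (assumption | rule al refl letters)+
    then show ?thesis using b unfolding in_kernel_def by blast
  next
    fix "is" i assume b: "\<beta> = - tri.wt (letter_count (i # is))"
    have b': "\<beta> = opp.wt (letter_count (i # is))" using b by (simp add: tri.opp_wt)
    have refl': "\<gamma> \<in> P" if "\<gamma> \<in> dual_space (smult G) (cartan G)"
      "\<gamma> - fun_scale (\<gamma> (- coroot G k)) (- simple_root G k) \<in> P" for \<gamma> k
    proof -
      have "\<gamma> (smult G (-1) (coroot G k)) = (-1) * \<gamma> (coroot G k)"
        using that(1) coroot_in unfolding dual_space_def by blast
      then have "\<gamma> - fun_scale (\<gamma> (- coroot G k)) (- simple_root G k) =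
          \<gamma> - fun_scale (\<gamma> (coroot G k)) (simple_root G k)"
        by (simp add: fun_eq_iff fun_scale_def)
      then show ?thesis using refl[of \<gamma> k] that(2) by simp
    qed
    have "(\<Sum>l\<in>UNIV. A $ k $ l * letter_count (i # is) l) = 0" for k
      by (rule opp.positive_weight_in_kernel[OF aff _ _ _ _ nP[unfolded b'] x(1)[unfolded b'] x(2)])
        (assumption | rule neg refl' letters)+
    then have "in_kernel (- letter_count (i # is))" by (simp add: in_kernel_def sum_negf)
    then show ?thesis using b unfolding tri.wt_minus[symmetric] by blast
  qed
qed

lemma form_add: "\<beta> \<in> cartan_dual G \<Longrightarrow> \<gamma> \<in> cartan_dual G \<Longrightarrow> \<mu> \<in> cartan_dual G \<Longrightarrow>
    B (\<beta> + \<gamma>) \<mu> = B \<beta> \<mu> + B \<gamma> \<mu>"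
  by (rule form[unfolded standard_form_def, THEN conjunct1, rule_format])

lemma form_scale: "\<beta> \<in> cartan_dual G \<Longrightarrow> \<mu> \<in> cartan_dual G \<Longrightarrow> B (fun_scale k \<beta>) \<mu> = k * B \<beta> \<mu>"
  by (rule form[unfolded standard_form_def, THEN conjunct2, THEN conjunct1, rule_format])

lemma form_sym: "\<beta> \<in> cartan_dual G \<Longrightarrow> \<mu> \<in> cartan_dual G \<Longrightarrow> B \<beta> \<mu> = B \<mu> \<beta>"
  by (rule form[unfolded standard_form_def, THEN conjunct2, THEN conjunct2, THEN conjunct1, rule_format])

lemma form_simple_root:
  obtains \<epsilon> :: "'n \<Rightarrow> real" where "\<And>i. \<epsilon> i > 0"
    "\<And>i \<beta>. \<beta> \<in> cartan_dual G \<Longrightarrow> B (simple_root G i) \<beta> = \<beta> (coroot G i) / of_real (\<epsilon> i)"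
proof -
  obtain \<epsilon> :: "'n \<Rightarrow> real" where \<epsilon>: "\<And>i. \<epsilon> i > 0"
    "\<And>i \<beta>. \<beta> \<in> cartan_dual G \<Longrightarrow> of_real (\<epsilon> i) * B (simple_root G i) \<beta> = \<beta> (coroot G i)"
    using form[unfolded standard_form_def, THEN conjunct2, THEN conjunct2, THEN conjunct2, THEN conjunct2]
    by blast
  have "B (simple_root G i) \<beta> = \<beta> (coroot G i) / of_real (\<epsilon> i)" if "\<beta> \<in> cartan_dual G" for i \<beta>
    using \<epsilon>(1)[of i] \<epsilon>(2)[OF that, of i] by (simp add: field_simps)
  then show ?thesis using that \<epsilon>(1) by blast
qed

lemma cartan_dual_closed:
  "0 \<in> cartan_dual G"
  "\<beta> \<in> cartan_dual G \<Longrightarrow> \<gamma> \<in> cartan_dual G \<Longrightarrow> \<beta> + \<gamma> \<in> cartan_dual G"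
  "\<beta> \<in> cartan_dual G \<Longrightarrow> fun_scale k \<beta> \<in> cartan_dual G"
  "simple_root G i \<in> cartan_dual G"
  "tri.wt c \<in> cartan_dual G"
  using simple_root_in[of i] tri.wt_in
  by (auto simp: cartan_dual_def dual_space_def fun_scale_def algebra_simps)

lemma form_zero: "\<mu> \<in> cartan_dual G \<Longrightarrow> B 0 \<mu> = 0"
  using form_scale[of 0 \<mu> 0] cartan_dual_closed(1) by (simp add: fun_scale_def zero_fun_def)

lemma form_wt:
  assumes "\<mu> \<in> cartan_dual G"
  shows "B (tri.wt c) \<mu> = (\<Sum>i\<in>UNIV. of_int (c i) * B (simple_root G i) \<mu>)"
proof -
  have main: "(\<Sum>i\<in>F. fun_scale (of_int (c i)) (simple_root G i)) \<in> cartan_dual G \<and>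
    B (\<Sum>i\<in>F. fun_scale (of_int (c i)) (simple_root G i)) \<mu> =
      (\<Sum>i\<in>F. of_int (c i) * B (simple_root G i) \<mu>)" for F
  proof (induction F rule: infinite_finite_induct)
    case (insert i F)
    let ?s = "\<Sum>i\<in>F. fun_scale (of_int (c i)) (simple_root G i)"
    let ?a = "fun_scale (of_int (c i)) (simple_root G i)"
    have a: "?a \<in> cartan_dual G" by (simp only: cartan_dual_closed)
    have "?a + ?s \<in> cartan_dual G" using insert.IH a cartan_dual_closed(2) by blast
    moreover have "B (?a + ?s) \<mu> = of_int (c i) * B (simple_root G i) \<mu> + B ?s \<mu>"
      by (simp only: form_add[OF a conjunct1[OF insert.IH] assms] form_scale[OF cartan_dual_closed(4) assms])
    ultimately show ?case using insert.IH by (simp only: sum.insert[OF insert.hyps])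
  qed (simp_all only: sum.empty sum.infinite form_zero[OF assms] cartan_dual_closed(1) simp_thms)
  have eq: "tri.wt c = (\<Sum>i\<in>UNIV. fun_scale (of_int (c i)) (simple_root G i))"
  proof
    fix h
    have "(\<Sum>i\<in>F. fun_scale (of_int (c i)) (simple_root G i)) h = (\<Sum>i\<in>F. of_int (c i) * simple_root G i h)" for F
      by (induction F rule: infinite_finite_induct) (auto simp: fun_scale_def)
    then show "tri.wt c h = (\<Sum>i\<in>UNIV. fun_scale (of_int (c i)) (simple_root G i)) h"
      by (simp add: tri.wt_def)
  qed
  show ?thesis unfolding eq by (rule main[THEN conjunct2])
qed

text \<open>
  Vectors in the kernel are in the radical of the form on the root lattice.
\<close>

lemma form_kernel:
  assumes "in_kernel c"
  shows "B (tri.wt c) (tri.wt d) = 0"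
proof -
  obtain \<epsilon> :: "'n \<Rightarrow> real" where "\<And>i. \<epsilon> i > 0" and
    \<epsilon>: "\<And>i \<beta>. \<beta> \<in> cartan_dual G \<Longrightarrow> B (simple_root G i) \<beta> = \<beta> (coroot G i) / of_real (\<epsilon> i)"
    using form_simple_root by metis
  have "tri.wt c (coroot G i) = 0" for i
    using assms tri.wt_hv[of c i] by (simp add: in_kernel_def del: of_int_sum)
  then have "B (simple_root G i) (tri.wt c) = 0" for i using \<epsilon>[OF cartan_dual_closed(5)] by simp
  then have "B (tri.wt d) (tri.wt c) = 0" using form_wt[OF cartan_dual_closed(5)] by simp
  then show ?thesis using form_sym cartan_dual_closed(5) by metis
qed

text \<open>
  Simple reflections preserve the form, so every real root has the norm \<open>2 / \<epsilon> i\<close> of a simple root.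
\<close>

lemma real_root_norm_nonzero:
  assumes "\<alpha> \<in> real_roots G"
  shows "B \<alpha> \<alpha> \<noteq> 0"
proof -
  obtain \<epsilon> :: "'n \<Rightarrow> real" where \<epsilon>: "\<And>i. \<epsilon> i > 0"
    "\<And>i \<beta>. \<beta> \<in> cartan_dual G \<Longrightarrow> B (simple_root G i) \<beta> = \<beta> (coroot G i) / of_real (\<epsilon> i)"
    using form_simple_root by metis
  have Aii: "A $ i $ i = 2" for i
    using affine by (simp add: affine_cartan_matrix_def generalized_cartan_matrix_def)
  have refl: "simple_reflection G i \<beta> \<in> cartan_dual G \<and>
      B (simple_reflection G i \<beta>) (simple_reflection G i \<beta>) = B \<beta> \<beta>" if b: "\<beta> \<in> cartan_dual G" for i \<beta>
  proof -
    define k where "k = - \<beta> (coroot G i)"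
    let ?a = "simple_root G i"
    have s: "simple_reflection G i \<beta> = fun_scale k ?a + \<beta>"
      by (simp add: simple_reflection_def k_def fun_eq_iff fun_scale_def)
    have a: "?a \<in> cartan_dual G" "fun_scale k ?a \<in> cartan_dual G" by (simp_all add: cartan_dual_closed)
    have sd: "fun_scale k ?a + \<beta> \<in> cartan_dual G" using a b by (simp add: cartan_dual_closed)
    have Ba: "B ?a \<beta> = - k / of_real (\<epsilon> i)" "B ?a ?a = 2 / of_real (\<epsilon> i)"
      using \<epsilon>(2)[OF b] \<epsilon>(2)[OF a(1)] simple_root_coroot Aii by (simp_all add: k_def)
    have 1: "B \<gamma> (fun_scale k ?a + \<beta>) = k * B ?a \<gamma> + B \<gamma> \<beta>" if "\<gamma> \<in> cartan_dual G" for \<gamma>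
      using form_sym[OF that sd] form_add[OF a(2) b that] form_scale[OF a(1) that] form_sym[OF b that] by simp
    have "B (fun_scale k ?a + \<beta>) (fun_scale k ?a + \<beta>) = k * B ?a (fun_scale k ?a + \<beta>) + B \<beta> (fun_scale k ?a + \<beta>)"
      using form_add[OF a(2) b sd] form_scale[OF a(1) sd] by simp
    also have "\<dots> = B \<beta> \<beta>"
      unfolding 1[OF a(1)] 1[OF b] Ba using \<epsilon>(1)[of i] by (simp add: field_simps)
    finally show ?thesis using s sd by simp
  qed
  from assms obtain w i where w: "w \<in> weyl_group G" "w \<alpha> = simple_root G i" and "\<alpha> \<in> cartan_dual G"
    by (auto simp: real_roots_def roots_def)
  from w(1) have "w \<alpha> \<in> cartan_dual G \<and> B (w \<alpha>) (w \<alpha>) = B \<alpha> \<alpha>"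
    by (induction rule: weyl_group.induct) (use \<open>\<alpha> \<in> cartan_dual G\<close> refl in auto)
  then have "B \<alpha> \<alpha> = 2 / of_real (\<epsilon> i)"
    using w(2) \<epsilon>(2)[OF cartan_dual_closed(4), of i i] simple_root_coroot Aii by simp
  then show ?thesis using \<epsilon>(1)[of i] by simp
qed

section \<open>Closed subroot systems and their subalgebras\<close>

context
  fixes \<Psi>
  assumes closed: "closed_subroot_system G B \<Psi>"
begin

lemma subsystem_real: "\<alpha> \<in> \<Psi> \<Longrightarrow> \<alpha> \<in> real_roots G"
  and subsystem_reflection: "\<alpha> \<in> \<Psi> \<Longrightarrow> \<beta> \<in> \<Psi> \<Longrightarrow> reflection B \<alpha> \<beta> \<in> \<Psi>"
  and subsystem_add: "\<alpha> \<in> \<Psi> \<Longrightarrow> \<beta> \<in> \<Psi> \<Longrightarrow> \<alpha> + \<beta> \<in> real_roots G \<Longrightarrow> \<alpha> + \<beta> \<in> \<Psi>"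
  using closed unfolding closed_subroot_system_def by auto

lemma subsystem_wt: "\<alpha> \<in> \<Psi> \<Longrightarrow> \<exists>c. \<alpha> = tri.wt c"
  using subsystem_real root_is_wt unfolding real_roots_def by blast

lemma subsystem_dual: "\<alpha> \<in> \<Psi> \<Longrightarrow> \<alpha> \<in> cartan_dual G"
  using subsystem_wt cartan_dual_closed(5) by metis

lemma subsystem_minus: "\<alpha> \<in> \<Psi> \<Longrightarrow> - \<alpha> \<in> \<Psi>"
proof -
  assume a: "\<alpha> \<in> \<Psi>"
  have "reflection B \<alpha> \<alpha> = - \<alpha>"
    using real_root_norm_nonzero[OF subsystem_real[OF a]]
    by (simp add: reflection_def cartan_pairing_def fun_eq_iff fun_scale_def)
  then show ?thesis using subsystem_reflection[OF a a] by simp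
qed

text \<open>
  The pairing of the two roots is \<open>2\<close>, because they differ by a vector in the radical. So reflecting
  one of them in the other reflects the parameters \<open>n\<close> about \<open>m\<close>, up to a sign that \<open>\<Psi>\<close> does not see.
\<close>

lemma subsystem_translate:
  assumes \<beta>: "\<beta> - fun_scale m \<mu> \<in> \<Psi>" "\<beta> - fun_scale n \<mu> \<in> \<Psi>"
    and \<mu>: "\<mu> \<in> cartan_dual G" "\<And>c. B \<mu> (tri.wt c) = 0"
  shows "\<beta> - fun_scale (2 * m - n) \<mu> \<in> \<Psi>"
proof -
  let ?a = "\<beta> - fun_scale m \<mu>" and ?b = "\<beta> - fun_scale n \<mu>"
  have b: "?b = fun_scale (m - n) \<mu> + ?a" by (simp add: fun_eq_iff fun_scale_def algebra_simps)
  have nb: "B (fun_scale (m - n) \<mu> + ?a) ?a = B ?a ?a"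
  proof -
    obtain c where c: "?a = tri.wt c" using subsystem_wt[OF \<beta>(1)] by blast
    have "B (fun_scale (m - n) \<mu>) ?a = 0"
      using form_scale[OF \<mu>(1) subsystem_dual[OF \<beta>(1)]] \<mu>(2)[of c] unfolding c by simp
    then show ?thesis
      using form_add[OF cartan_dual_closed(3)[OF \<mu>(1)] subsystem_dual[OF \<beta>(1)] subsystem_dual[OF \<beta>(1)]]
      by simp
  qed
  have "cartan_pairing B ?b ?a = 2"
    unfolding cartan_pairing_def b nb using real_root_norm_nonzero[OF subsystem_real[OF \<beta>(1)]]
    by (rule nonzero_mult_div_cancel_right)
  then have "- reflection B ?a ?b = \<beta> - fun_scale (2 * m - n) \<mu>"
    by (simp add: reflection_def fun_eq_iff fun_scale_def algebra_simps)
  then show ?thesis using subsystem_minus[OF subsystem_reflection[OF \<beta>]] by simp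
qed

text \<open>
  The one case in which closedness under addition says nothing: \<open>\<alpha>\<close> and \<open>\<gamma>\<close> are both opposite to \<open>\<beta>\<close>
  modulo the kernel. The roots of \<open>\<Psi>\<close> on the line through \<open>\<beta>\<close> in the direction of the kernel are
  described by a set of integers that is closed under reflections. With suitable \<open>p\<close> and \<open>q\<close> this set
  contains \<open>0\<close>, \<open>p\<close> and \<open>q\<close>, from \<open>\<beta>\<close>, \<open>- \<alpha>\<close> and \<open>- \<gamma>\<close>; its element \<open>p + q\<close> belongs to \<open>- (\<alpha> + \<beta> + \<gamma>)\<close>.
\<close>

lemma subsystem_sum_three:
  assumes abc: "\<alpha> \<in> \<Psi>" "\<beta> \<in> \<Psi>" "\<gamma> \<in> \<Psi>"
    and c: "\<alpha> + \<beta> = tri.wt c" "in_kernel c" and d: "\<beta> + \<gamma> = tri.wt d" "in_kernel d"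
  shows "\<alpha> + \<beta> + \<gamma> \<in> \<Psi>"
proof -
  consider "c = 0" | "d = 0" | "c \<noteq> 0" "d \<noteq> 0" by blast
  then show ?thesis
  proof cases
    case 1
    then show ?thesis using c(1) abc(3) by (simp only: tri.wt_zero add_0_left)
  next
    case 2
    then show ?thesis using d(1) abc(1) by (simp only: tri.wt_zero add_0_right add.assoc)
  next
    case 3
    have proportional: "c i * d j = d i * c j" for i j
      by (rule affine_kernel_proportional[OF aff]) (use c(2) d(2) in \<open>auto simp: in_kernel_def\<close>)
    obtain i where i: "c i \<noteq> 0" using 3(1) by (auto simp: fun_eq_iff)
    define g p q where "g = gcd (c i) (d i)" and "p = c i div g" and "q = d i div g"
    have g: "g \<noteq> 0" using i by (simp add: g_def)
    have pq: "c i = p * g" "d i = q * g" by (simp_all add: p_def q_def g_def)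
    have "coprime p q" using i unfolding p_def q_def g_def by (intro div_gcd_coprime) simp
    have p0: "p \<noteq> 0" using i pq by auto
    \<comment> \<open>A common measure of both kernel vectors: they are \<open>p \<mu>\<close> and \<open>q \<mu>\<close> with coprime \<open>p\<close>, \<open>q\<close>.\<close>
    define \<mu> where "\<mu> = fun_scale (1 / of_int p) (tri.wt c)"
    have \<mu>: "\<mu> \<in> cartan_dual G" "B \<mu> (tri.wt e) = 0" for e
      using cartan_dual_closed(5)[of c] form_kernel[OF c(2)] form_scale[OF cartan_dual_closed(5) cartan_dual_closed(5)]
      by (simp_all add: \<mu>_def cartan_dual_closed)
    have wc: "tri.wt c = fun_scale (of_int p) \<mu>"
      using p0 by (simp add: \<mu>_def fun_scale_def)
    have "of_int (d j) = (of_int q * (of_int (c j) / of_int p) :: complex)" for j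
    proof -
      have "p * g * d j = q * g * c j" using proportional[of i j] pq by simp
      then have "g * (p * d j) = g * (q * c j)" by (simp only: ac_simps)
      then have "p * d j = q * c j" using g by simp
      then have "of_int (p * d j) = (of_int (q * c j) :: complex)" by simp
      then show ?thesis using p0 by (simp add: field_simps)
    qed
    then have wd: "tri.wt d = fun_scale (of_int q) \<mu>"
      by (simp add: \<mu>_def fun_scale_def tri.wt_def fun_eq_iff sum_distrib_left mult.assoc)
    define T where "T = {n. \<beta> - fun_scale (of_int n) \<mu> \<in> \<Psi>}"
    have "p + q \<in> T"
    proof (rule int_reflection_closed_sum[OF _ _ _ _ \<open>coprime p q\<close>])
      show "0 \<in> T" using abc(2) by (simp add: T_def fun_scale_def fun_diff_def)
      have "\<beta> - (\<alpha> + \<beta>) \<in> \<Psi>" "\<beta> - (\<beta> + \<gamma>) \<in> \<Psi>" using subsystem_minus abc by simp_all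
      then show "p \<in> T" "q \<in> T" unfolding c(1) d(1) wc wd by (simp_all add: T_def)
      show "2 * m - n \<in> T" if "m \<in> T" "n \<in> T" for m n
        using subsystem_translate[OF _ _ \<mu>] that unfolding T_def by fastforce
    qed
    then have "\<beta> - fun_scale (of_int (p + q)) \<mu> \<in> \<Psi>" by (simp only: T_def mem_Collect_eq)
    moreover have 1: "\<beta> - fun_scale (of_int (p + q)) \<mu> = \<beta> - tri.wt c - tri.wt d"
      unfolding wc wd by (simp add: fun_eq_iff fun_scale_def algebra_simps)
    moreover have 2: "\<beta> - tri.wt c - tri.wt d = - (\<alpha> + \<beta> + \<gamma>)"
      unfolding c(1)[symmetric] d(1)[symmetric] by simp
    ultimately have "- (\<alpha> + \<beta> + \<gamma>) \<in> \<Psi>" by (simp only: 1 2)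
    from subsystem_minus[OF this] show ?thesis by (simp only: minus_minus)
  qed
qed

lemma nonreal_bracket_kernel:
  assumes "\<alpha> \<in> \<Psi>" "\<beta> \<in> \<Psi>" "x \<in> root_space G \<alpha>" "y \<in> root_space G \<beta>"
    "\<alpha> + \<beta> \<notin> real_roots G" "bracket G x y \<noteq> 0"
  shows "\<exists>c. \<alpha> + \<beta> = tri.wt c \<and> in_kernel c"
proof (cases "\<alpha> + \<beta> = 0")
  case True
  then have "\<alpha> + \<beta> = tri.wt 0" by (simp only: tri.wt_zero)
  moreover have "in_kernel 0" by (simp add: in_kernel_def)
  ultimately show ?thesis by blast
next
  case False
  have "bracket G x y \<in> root_space G (\<alpha> + \<beta>)"
    using bracket_weight_space assms(3,4) by (simp only: root_space_eq)
  then have "\<alpha> + \<beta> \<in> roots G"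
    using False assms(6) cartan_dual_closed(2) subsystem_dual assms(1,2) by (auto simp: roots_def)
  then show ?thesis using nonreal_root_in_kernel assms(5) by blast
qed

text \<open>
  The span of the root spaces of \<open>\<Psi>\<close> and of those brackets of two of them whose weight is not a real
  root is already closed under the bracket. By the Jacobi identity this comes down to brackets
  \<open>[[z, x], y]\<close> of three root vectors for which the weight of \<open>[x, y]\<close> is not a real root.
\<close>

lemma generated_subalgebra_weights:
  "generated_subalgebra G \<Psi> \<subseteq>
    span (\<Union>\<mu>\<in>\<Psi> \<union> {\<alpha> + \<beta> | \<alpha> \<beta>. \<alpha> \<in> \<Psi> \<and> \<beta> \<in> \<Psi> \<and> \<alpha> + \<beta> \<notin> real_roots G}. weight_space (cartan G) \<mu>)"
proof -
  let ?M = "\<Union>\<alpha>\<in>\<Psi>. root_space G \<alpha>"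
  let ?N = "{bracket G x y | x y \<alpha> \<beta>. \<alpha> \<in> \<Psi> \<and> \<beta> \<in> \<Psi> \<and> x \<in> root_space G \<alpha> \<and> y \<in> root_space G \<beta> \<and>
    \<alpha> + \<beta> \<notin> real_roots G}"
  let ?V = "span (?M \<union> ?N)"
  have sV: "subspace ?V" by (rule subspace_span)
  have M: "x \<in> ?V" if "\<alpha> \<in> \<Psi>" "x \<in> root_space G \<alpha>" for x \<alpha> using that by (blast intro: span_base)
  have br: "bracket G x y \<in> root_space G (\<alpha> + \<beta>)" if "x \<in> root_space G \<alpha>" "y \<in> root_space G \<beta>" for x y \<alpha> \<beta>
    using bracket_weight_space that by (simp only: root_space_eq)
  have MM: "bracket G x y \<in> ?V"
    if "\<alpha> \<in> \<Psi>" "\<beta> \<in> \<Psi>" "x \<in> root_space G \<alpha>" "y \<in> root_space G \<beta>" for x y \<alpha> \<beta>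
  proof (cases "\<alpha> + \<beta> \<in> real_roots G")
    case True
    then show ?thesis using M[OF subsystem_add[OF that(1,2)] br[OF that(3,4)]] by blast
  next
    case False
    then have "bracket G x y \<in> ?N" using that by blast
    then show ?thesis by (blast intro: span_base)
  qed
  have MMM: "bracket G (bracket G z x) y \<in> ?V"
    if m: "\<alpha> \<in> \<Psi>" "\<beta> \<in> \<Psi>" "\<gamma> \<in> \<Psi>" and r: "x \<in> root_space G \<alpha>" "y \<in> root_space G \<beta>" "z \<in> root_space G \<gamma>"
      and n: "\<alpha> + \<beta> \<notin> real_roots G" "bracket G x y \<noteq> 0" for x y z \<alpha> \<beta> \<gamma>
  proof -
    consider "\<gamma> + \<alpha> \<in> real_roots G" | "bracket G z x = 0" | "\<gamma> + \<alpha> \<notin> real_roots G" "bracket G z x \<noteq> 0"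
      by blast
    then show ?thesis
    proof cases
      case 1
      then show ?thesis using MM[OF subsystem_add[OF m(3,1)] m(2) br[OF r(3,1)] r(2)] by blast
    next
      case 2
      then show ?thesis by (simp add: span_zero)
    next
      case 3
      \<comment> \<open>Both partial sums lie in the kernel, so the total weight is in \<open>\<Psi>\<close>.\<close>
      obtain c where c: "\<gamma> + \<alpha> = tri.wt c" "in_kernel c"
        using nonreal_bracket_kernel[OF m(3,1) r(3,1) 3] by blast
      obtain d where d: "\<alpha> + \<beta> = tri.wt d" "in_kernel d"
        using nonreal_bracket_kernel[OF m(1,2) r(1,2) n] by blast
      have "\<gamma> + \<alpha> + \<beta> \<in> \<Psi>" by (rule subsystem_sum_three[OF m(3,1,2) c d])
      then show ?thesis using M br[OF br[OF r(3,1)] r(2)] by blast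
    qed
  qed
  have MN: "bracket G z s \<in> ?V" if z: "\<gamma> \<in> \<Psi>" "z \<in> root_space G \<gamma>" and sN: "s \<in> ?N" for z \<gamma> s
  proof -
    obtain x y \<alpha> \<beta> where s: "s = bracket G x y" "\<alpha> \<in> \<Psi>" "\<beta> \<in> \<Psi>" "x \<in> root_space G \<alpha>" "y \<in> root_space G \<beta>"
      "\<alpha> + \<beta> \<notin> real_roots G" using sN by blast
    show ?thesis
    proof (cases "s = 0")
      case True
      then show ?thesis by (simp add: span_zero)
    next
      case False
      have "bracket G y x \<noteq> 0" using False s(1) bracket_anticomm[of x y] by auto
      moreover have "\<beta> + \<alpha> \<notin> real_roots G" using s(6) by (simp add: add.commute)
      ultimately have "bracket G (bracket G z y) x \<in> ?V"
        using MMM[OF s(3,2) z(1) s(5,4) z(2)] by blast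
      then have "- bracket G (bracket G z y) x \<in> ?V" by (rule span_neg)
      then have "bracket G x (bracket G z y) \<in> ?V"
        using bracket_anticomm[of x "bracket G z y"] by simp
      moreover have "bracket G (bracket G z x) y \<in> ?V"
        using MMM[OF s(2,3) z(1) s(4,5) z(2) s(6)] False s(1) by blast
      ultimately show ?thesis
        unfolding s(1) bracket_derivation[of z x y] by (intro span_add)
    qed
  qed
  have MV: "bracket G z v \<in> ?V" if "\<gamma> \<in> \<Psi>" "z \<in> root_space G \<gamma>" "v \<in> ?V" for z \<gamma> v
    by (rule bracket_span[OF sV _ that(3)]) (use MM MN that(1,2) in blast)
  have NV: "bracket G s v \<in> ?V" if sN: "s \<in> ?N" and "v \<in> ?V" for s v
  proof -
    obtain x y \<alpha> \<beta> where s: "s = bracket G x y" "\<alpha> \<in> \<Psi>" "\<beta> \<in> \<Psi>" "x \<in> root_space G \<alpha>" "y \<in> root_space G \<beta>"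
      using sN by blast
    have "bracket G s v = bracket G x (bracket G y v) - bracket G y (bracket G x v)"
      using bracket_derivation[of x y v] s(1) by simp
    then show ?thesis using MV s that(2) by (simp add: span_diff)
  qed
  have "bracket G u v \<in> ?V" if "u \<in> ?V" "v \<in> ?V" for u v
    by (rule bracket_span_left[OF sV _ that(1)]) (use MV NV that(2) in blast)
  then have "lie_subalgebra ?V" using sV by (simp add: lie_subalgebra_def)
  then have "generated_subalgebra G \<Psi> \<subseteq> ?V"
    unfolding generated_subalgebra_def
    by (rule subalgebra_hull_minimal) (blast intro: span_base)
  also have "?V \<subseteq> span (\<Union>\<mu>\<in>\<Psi> \<union> {\<alpha> + \<beta> | \<alpha> \<beta>. \<alpha> \<in> \<Psi> \<and> \<beta> \<in> \<Psi> \<and> \<alpha> + \<beta> \<notin> real_roots G}. weight_space (cartan G) \<mu>)"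
    by (rule span_mono) (use br in \<open>unfold root_space_eq, blast\<close>)
  finally show ?thesis .
qed

text \<open>
  A real root of the subalgebra is one of the weights found above, and the sums among these are not
  real by their choice.
\<close>

lemma subsystem_recovered: "\<Psi> = subalgebra_roots G \<Psi> \<inter> real_roots G"
proof
  show "\<Psi> \<subseteq> subalgebra_roots G \<Psi> \<inter> real_roots G"
  proof
    fix \<alpha> assume a: "\<alpha> \<in> \<Psi>"
    then have "\<alpha> \<in> real_roots G" by (rule subsystem_real)
    moreover have "root_space G \<alpha> \<subseteq> generated_subalgebra G \<Psi>"
      using a unfolding generated_subalgebra_def by (blast intro: hull_inc)
    ultimately show "\<alpha> \<in> subalgebra_roots G \<Psi> \<inter> real_roots G"
      by (auto simp: subalgebra_roots_def real_roots_def roots_def Int_absorb2)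
  qed
  show "subalgebra_roots G \<Psi> \<inter> real_roots G \<subseteq> \<Psi>"
  proof
    fix \<alpha> assume a: "\<alpha> \<in> subalgebra_roots G \<Psi> \<inter> real_roots G"
    let ?S = "\<Psi> \<union> {\<alpha> + \<beta> | \<alpha> \<beta>. \<alpha> \<in> \<Psi> \<and> \<beta> \<in> \<Psi> \<and> \<alpha> + \<beta> \<notin> real_roots G}"
    have "0 \<in> root_space G \<alpha> \<inter> generated_subalgebra G \<Psi>"
    proof -
      have "0 \<in> T" if "lie_subalgebra T" for T using that by (auto simp: lie_subalgebra_def subspace_0)
      then have "0 \<in> generated_subalgebra G \<Psi>" unfolding generated_subalgebra_def hull_def by blast
      then show ?thesis by (simp add: root_space_eq subspace_0[OF subspace_weight_space])
    qed
    then obtain x where x: "x \<in> root_space G \<alpha>" "x \<in> generated_subalgebra G \<Psi>" "x \<noteq> 0"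
      using a unfolding subalgebra_roots_def by blast
    have "?S \<subseteq> dual_space (smult G) (cartan G)"
      using subsystem_dual cartan_dual_closed(2) unfolding cartan_dual_def by blast
    moreover have "\<alpha> \<in> dual_space (smult G) (cartan G)"
      using a by (simp add: subalgebra_roots_def roots_def cartan_dual_def)
    moreover have "x \<in> span (\<Union>\<mu>\<in>?S. weight_space (cartan G) \<mu>)"
      using x(2) generated_subalgebra_weights by blast
    ultimately have "\<alpha> \<in> ?S"
      using weight_vector_in_span x(1,3) unfolding root_space_eq by blast
    then show "\<alpha> \<in> \<Psi>" using a by blast
  qed
qed

end

end

theorem corollary12p1p5:
  fixes G :: "('g::ab_group_add, 'n::finite) km_data"
    and A :: "int^'n^'n"
    and B :: "('g \<Rightarrow> complex) \<Rightarrow> ('g \<Rightarrow> complex) \<Rightarrow> complex"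
  assumes "affine_kac_moody_algebra G A"
    and "standard_form G B"
  shows "(\<forall>\<Psi>. closed_subroot_system G B \<Psi> \<longrightarrow> \<Psi> = subalgebra_roots G \<Psi> \<inter> real_roots G) \<and>
    bij_betw (generated_subalgebra G) {\<Psi>. closed_subroot_system G B \<Psi>}
      {S. regular_subalgebra G B S}"
proof -
  interpret kac_moody_algebra G A
    using assms(1) by (simp add: affine_kac_moody_algebra_def)
  interpret affine_kac_moody_with_form G A B
    by unfold_locales (use assms in \<open>auto simp: affine_kac_moody_algebra_def\<close>)
  have recovered: "\<Psi> = subalgebra_roots G \<Psi> \<inter> real_roots G" if "closed_subroot_system G B \<Psi>" for \<Psi>
    by (rule subsystem_recovered[OF that])
  moreover have "inj_on (generated_subalgebra G) {\<Psi>. closed_subroot_system G B \<Psi>}"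
  proof (rule inj_onI, unfold mem_Collect_eq)
    fix \<Psi> \<Psi>' assume cl: "closed_subroot_system G B \<Psi>" "closed_subroot_system G B \<Psi>'"
      and "generated_subalgebra G \<Psi> = generated_subalgebra G \<Psi>'"
    then have "subalgebra_roots G \<Psi> = subalgebra_roots G \<Psi>'" by (simp add: subalgebra_roots_def)
    then show "\<Psi> = \<Psi>'" using recovered[OF cl(1)] recovered[OF cl(2)] by simp
  qed
  moreover have "generated_subalgebra G ` {\<Psi>. closed_subroot_system G B \<Psi>} = {S. regular_subalgebra G B S}"
    by (auto simp: regular_subalgebra_def)
  ultimately show ?thesis unfolding bij_betw_def by blast
qed

end
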